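(* Let $m\ge 0$, $n\ge 1$ be integers, let $A\in\mathbb{Z}^{(n+m)\times n}$ with $\operatorname{rank}(A)=n$, let $b\in\mathbb{Z}^{n+m}$, and put $\Delta=\Delta(A)$. Let $v$ be any vertex of the integer hull $P_I(A,b)=\operatorname{conv}(\{x\in\mathbb{R}^n: Ax\le b\}\cap\mathbb{Z}^n)$, and let $u=b-Av$ be the corresponding slack vector. Then: 1. $\|u\|_0\le m+\log_2\sqrt{\det(A^\top A)}$ (here $\sqrt{\det(A^\top A)}$ is the determinant of the lattice $\{At: t\in\mathbb{Z}^n\}$); 2. if $m\ge 1$, then $\|u\|_0\le c\cdot m+\log_2(\Delta)+\frac{m}{2}\log_2\!\left(\log_2\sqrt{2e}+\frac{\log_2(\Delta)}{m}\right)$, where $c=\log_2\sqrt{\frac{2e^2}{e-\log_2 e}}+\frac12\le 2.27$. Additionally, if the system $Ax\le b$ is $\mathcal{B}$-normalized for a basis $\mathcal{B}$ and $\delta=|\det(A_{\mathcal{B}})|$, then $\|v\|_0\le\|u\|_0+\log_2(\delta)$.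
   Context: For an integer matrix $M$ of rank $r$, $\Delta(M)$ is the maximum absolute value of the determinants of the $r\times r$ submatrices of $M$. $\|x\|_0$ is the number of nonzero coordinates of $x$. For $I$ a set of row indices, $A_I$ is the submatrix of rows in $I$. A basis is a set $\mathcal{B}$ of $n$ row indices with $A_{\mathcal{B}}$ nonsingular. The system $Ax\le b$ is called $\mathcal{B}$-normalized if (after permuting rows and columns of $A_{\mathcal{B}}$ correspondingly) $A_{\mathcal{B}}$ is a lower triangular matrix in Hermite normal form of the block shape $A_{\mathcal{B}}=\begin{pmatrix} I_{s\times s} & 0\\ H & T\end{pmatrix}$, where $T$ is lower triangular with all diagonal entries $\ge 2$, $0\le (A_{\mathcal{B}})_{ij}<(A_{\mathcal{B}})_{ii}$ for all $j<i$, the columns of $H$ are sorted lexicographically, and $0\le b_{\mathcal{B}}<\operatorname{diag}(A_{\mathcal{B}})$ componentwise. *)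

theory Defs
  imports "HOL-Analysis.Analysis"
begin

abbreviation real_mat :: "int ^ 'n ^ 'r \<Rightarrow> real ^ 'n ^ 'r" where
  "real_mat A \<equiv> map_matrix real_of_int A"

definition real_vec :: "int ^ 'n \<Rightarrow> real ^ 'n" where
  "real_vec b = (\<chi> i. real_of_int (b $ i))"

definition norm0 :: "real ^ 'n \<Rightarrow> nat" where
  "norm0 x = card {i. x $ i \<noteq> 0}"

(* The determinant of the square submatrix of M with columns J and rows h ` J
   (h injective on J), the row h j being placed in the position of the column j. So that
   the library determinant applies, the submatrix is bordered by an identity block outside J;
   this leaves the value unchanged. A different choice of h with the same image h ` J
   changes at most the sign. *)
definition subdet :: "int ^ 'n ^ 'r \<Rightarrow> 'n set \<Rightarrow> ('n \<Rightarrow> 'r) \<Rightarrow> int" where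
  "subdet M J h =
     det (\<chi> i j. if i \<in> J \<and> j \<in> J then M $ h i $ j else if i = j then 1 else 0)"

definition max_subdet :: "int ^ 'n ^ 'r \<Rightarrow> int" where
  "max_subdet M =
     Max {\<bar>subdet M J h\<bar> | J h. card J = rank (real_mat M) \<and> inj_on h J}"

definition polyhedron_of :: "int ^ 'n ^ 'r \<Rightarrow> int ^ 'r \<Rightarrow> (real ^ 'n) set" where
  "polyhedron_of A b = {x. \<forall>i. (real_mat A *v x) $ i \<le> real_vec b $ i}"

definition integer_points :: "(real ^ 'n) set" where
  "integer_points = {x. \<forall>j. x $ j \<in> \<int>}"

definition integer_hull :: "int ^ 'n ^ 'r \<Rightarrow> int ^ 'r \<Rightarrow> (real ^ 'n) set" where
  "integer_hull A b = convex hull (polyhedron_of A b \<inter> integer_points)"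

(* The square matrix whose rows are the rows of A with indices h i. For a set B of CARD('n)
   row indices, A_B is given by any h with bij_betw h UNIV B: another h permutes the rows. *)
definition row_submatrix :: "int ^ 'n ^ 'r \<Rightarrow> ('n \<Rightarrow> 'r) \<Rightarrow> int ^ 'n ^ 'n" where
  "row_submatrix A h = (\<chi> i. A $ h i)"

definition is_basis :: "int ^ 'n ^ 'r \<Rightarrow> 'r set \<Rightarrow> bool" where
  "is_basis A B \<longleftrightarrow> (\<exists>h. bij_betw h UNIV B \<and> det (row_submatrix A h) \<noteq> 0)"

(* The orderings p of the rows in B and q of the columns are the permutations that bring A_B
   into the block shape (I 0; H T), with s the size of the identity block. The direction of
   the lexicographic order on the columns of H is immaterial: reversing p and q on {..<s}
   reverses these columns and keeps everything else. *)
definition normalized :: "int ^ 'n ^ 'r \<Rightarrow> int ^ 'r \<Rightarrow> 'r set \<Rightarrow> bool" where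
  "normalized A b B \<longleftrightarrow>
     (\<exists>(s::nat) (p :: nat \<Rightarrow> 'r) (q :: nat \<Rightarrow> 'n).
        let n = CARD('n); M = (\<lambda>i j. A $ p i $ q j) in
          s \<le> n \<and> bij_betw p {..<n} B \<and> bij_betw q {..<n} UNIV \<and>
          (\<forall>i<s. \<forall>j<s. M i j = (if i = j then 1 else 0)) \<and>
          (\<forall>i<n. \<forall>j<n. i < j \<longrightarrow> M i j = 0) \<and>
          (\<forall>i<n. s \<le> i \<longrightarrow> 2 \<le> M i i) \<and>
          (\<forall>i<n. \<forall>j<i. 0 \<le> M i j \<and> M i j < M i i) \<and>
          (\<forall>j<s. \<forall>k<s. j < k \<longrightarrow>
             ord_class.lexordp_eq (map (\<lambda>i. M i j) [s..<n]) (map (\<lambda>i. M i k) [s..<n])) \<and>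
          (\<forall>i<n. 0 \<le> b $ p i \<and> b $ p i < M i i))"

end

theory Submission
  imports Defs "HOL-Probability.Distributions"
begin

text \<open>
  Let \<open>S\<close> be the support of \<open>u\<close>, and let \<open>T\<close> index a maximal independent set of tight rows. If
  \<open>t \<noteq> 0\<close> is an integer vector with \<open>A\<^sub>i t = 0\<close> off \<open>S\<close> and \<open>\<bar>A\<^sub>i t\<bar> \<le> 1\<close> on \<open>S\<close>, then \<open>v + t\<close> and
  \<open>v - t\<close> are feasible and \<open>v\<close> is not a vertex. On the other hand, a system of forms \<open>N\<close> with
  \<open>det (N\<^sup>T N) < 1\<close> has a nonzero integer point with \<open>\<bar>N\<^sub>i t\<bar> < 1\<close> for all \<open>i\<close>: by Vaaler's
  cube-slicing inequality the body \<open>\<bar>N\<^sub>i t\<bar> < 1/2\<close> has volume at least \<open>det (N\<^sup>T N)\<close> to the power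
  \<open>-1/2\<close>, and Blichfeldt's principle applies. Taking for \<open>N\<close> the rows in \<open>T\<close> and one half of the
  projections of the rows in \<open>S\<close>, the Cauchy--Binet formula gives
  \<open>4\<^sup>d \<le> \<Sum> (det A\<^sub>J)\<^sup>2\<close>, summed over the bases \<open>J\<close> with \<open>T \<subseteq> J \<subseteq> S \<union> T\<close>, where \<open>d = n - card T \<ge> card S - m\<close>.
  The sum is at most \<open>det (A\<^sup>T A)\<close>, and also at most \<open>\<Delta>\<^sup>2\<close> times a binomial coefficient.

  Vaaler's inequality rests on Brunn--Minkowski: the volume of a symmetric convex body cut by a slab
  is concave in the width of the slab, so a Gaussian factor can only decrease the volume when it
  replaces a slab of the same mass.
\<close>

section \<open>Volumes of convex combinations\<close>

text \<open>Brunn-Minkowski enters in a single situation: a layer of a symmetric body and the mirror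
  image of that layer. The two volumes agree, so the case of equal volumes suffices; for two boxes
  it is the weighted inequality of arithmetic and geometric means, and no exponent depending on the
  dimension appears. The Gaussian \<open>exp (- pi * s\<^sup>2)\<close> has the height and the mass
  of the indicator of a slab of half-width 1/2, and its product over the forms \<open>N\<close>
  integrates to exactly the power -1/2 of the Gram determinant. This is why the two are compared.
  The factor one half on the rows in \<open>S\<close> exploits integrality: if half of an integer is
  less than 1 in absolute value, the integer is -1, 0 or 1, which a nonzero integral slack can
  absorb in both directions. A minor that contains all of \<open>T\<close> has \<open>d\<close>
  further rows, each scaled by 1/2, and squaring turns this into \<open>4 ^ d\<close>. Sums over
  minors run over functions from column indices to row indices rather than over sets of rows; every
  set is then counted once for each of its orderings, whence the factorials that cancel at the
  end.\<close>

lemma bounded_open_fmeasurable: "bounded S \<Longrightarrow> open S \<Longrightarrow> S \<in> fmeasurable (lborel :: 'a::euclidean_space measure)"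
  using emeasure_bounded_finite[of S] by (auto simp: fmeasurable_def)

lemma bounded_borel_fmeasurable:
  "bounded S \<Longrightarrow> S \<in> sets borel \<Longrightarrow> S \<in> fmeasurable (lborel :: 'a::euclidean_space measure)"
  using emeasure_bounded_finite[of S] by (auto simp: fmeasurable_def)

lemma box_Int_greaterThan:
  fixes a b :: "'a::euclidean_space"
  assumes "i \<in> Basis"
  shows "\<exists>a'. box a b \<inter> {x. c < x \<bullet> i} = box a' b"
proof
  show "box a b \<inter> {x. c < x \<bullet> i} =
    box (\<Sum>j\<in>Basis. (if j = i then max c (a \<bullet> i) else a \<bullet> j) *\<^sub>R j) b"
    using assms by (auto simp: box_def split: if_splits)
qed

lemma box_Int_lessThan:
  fixes a b :: "'a::euclidean_space"
  assumes "i \<in> Basis"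
  shows "\<exists>b'. box a b \<inter> {x. x \<bullet> i < c} = box a b'"
proof
  show "box a b \<inter> {x. x \<bullet> i < c} =
    box a (\<Sum>j\<in>Basis. (if j = i then min c (b \<bullet> i) else b \<bullet> j) *\<^sub>R j)"
    using assms by (auto simp: box_def split: if_splits)
qed

lemma null_sets_hyperplane:
  fixes i :: "'a::euclidean_space"
  assumes "i \<noteq> 0"
  shows "{x. i \<bullet> x = c} \<in> null_sets lborel"
proof -
  have "negligible {x. i \<bullet> x = c}"
    using assms by (intro negligible_hyperplane) auto
  moreover have "{x. i \<bullet> x = c} \<in> sets borel"
    by (intro borel_closed closed_hyperplane)
  ultimately show ?thesis
    by (auto simp: negligible_iff_null_sets null_sets_completion_iff)
qed

lemma measure_hyperplane_cut:
  fixes i :: "'a::euclidean_space"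
  assumes S: "bounded S" "S \<in> sets borel" and i: "i \<noteq> 0"
  shows "measure lborel S = measure lborel (S \<inter> {x. c < x \<bullet> i}) + measure lborel (S \<inter> {x. x \<bullet> i < c})"
proof -
  have sets: "{x. c < x \<bullet> i} \<in> sets borel" "{x. x \<bullet> i < c} \<in> sets borel"
    by (auto intro!: borel_open open_Collect_less continuous_intros)
  let ?U = "(S \<inter> {x. c < x \<bullet> i}) \<union> (S \<inter> {x. x \<bullet> i < c})"
  have eq: "?U = S - {x. i \<bullet> x = c}"
    by (auto simp: inner_commute)
  have fm: "S \<inter> {x. c < x \<bullet> i} \<in> fmeasurable lborel" "S \<inter> {x. x \<bullet> i < c} \<in> fmeasurable lborel"
    using S sets by (auto intro!: bounded_borel_fmeasurable)
  have "measure lborel S = measure lborel ?U"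
    unfolding eq using null_sets_hyperplane[OF i] S by (simp add: measure_Diff_null_set)
  also have "\<dots> = measure lborel (S \<inter> {x. c < x \<bullet> i}) + measure lborel (S \<inter> {x. x \<bullet> i < c})"
    using fm by (intro measure_Union) (auto simp: fmeasurable_def)
  finally show ?thesis .
qed

text \<open>Raising the hyperplane removes at most a slice of an enclosing box, so the volume above
  it is a Lipschitz function of the height. It falls from the full volume to 0, and the intermediate
  value theorem applies.\<close>

lemma exists_hyperplane_cut:
  fixes i :: "'a::euclidean_space"
  assumes S: "bounded S" "S \<in> sets borel" and i: "i \<in> Basis"
    and t: "0 \<le> t" "t \<le> measure lborel S"
  shows "\<exists>c. measure lborel (S \<inter> {x. c < x \<bullet> i}) = t"
proof -
  obtain l u where lu: "S \<subseteq> cbox l u"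
    using S(1) bounded_subset_cbox_symmetric by blast
  define f where "f c = measure lborel (S \<inter> {x. c < x \<bullet> i})" for c
  have sets: "{x. c < x \<bullet> i} \<in> sets borel" for c
    by (auto intro!: borel_open open_Collect_less continuous_intros)
  have fm: "S \<inter> {x. c < x \<bullet> i} \<in> fmeasurable lborel" for c
    using S sets by (auto intro!: bounded_borel_fmeasurable)
  \<comment> \<open>This is the cross-section of the enclosing box orthogonal to \<open>i\<close>.
    The absolute values keep it nonnegative even if the box is empty.\<close>
  define C where "C = (\<Prod>j\<in>Basis - {i}. \<bar>(u - l) \<bullet> j\<bar>)"
  have C0: "0 \<le> C"
    unfolding C_def by (intro prod_nonneg) auto
  have lip: "0 \<le> f c - f c' \<and> f c - f c' \<le> C * (c' - c)" if "c \<le> c'" for c c'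
  proof -
    let ?l = "\<Sum>j\<in>Basis. (if j = i then c else l \<bullet> j) *\<^sub>R j"
    let ?u = "\<Sum>j\<in>Basis. (if j = i then c' else u \<bullet> j) *\<^sub>R j"
    let ?D = "(S \<inter> {x. c < x \<bullet> i}) - (S \<inter> {x. c' < x \<bullet> i})"
    have "f c - f c' = measure lborel ?D"
      unfolding f_def using that fm[of c] fm[of c']
      by (subst measure_Diff) (auto simp: fmeasurable_def)
    moreover have "measure lborel ?D \<le> measure lborel (cbox ?l ?u)"
    proof (rule measure_mono_fmeasurable)
      show "?D \<subseteq> cbox ?l ?u"
        using lu i by (auto simp: cbox_def split: if_splits)
      show "?D \<in> sets lborel"
        using S sets by auto
    qed (auto intro!: bounded_borel_fmeasurable)
    moreover have "measure lborel (cbox ?l ?u) \<le> C * (c' - c)"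
    proof (cases "\<forall>b\<in>Basis. ?l \<bullet> b \<le> ?u \<bullet> b")
      case True
      have "measure lborel (cbox ?l ?u) = (\<Prod>b\<in>Basis. (?u - ?l) \<bullet> b)"
        using True by (simp add: measure_lborel_cbox_eq)
      also have "\<dots> = ((?u - ?l) \<bullet> i) * (\<Prod>b\<in>Basis - {i}. (?u - ?l) \<bullet> b)"
        using i by (intro prod.remove) auto
      also have "(\<Prod>b\<in>Basis - {i}. (?u - ?l) \<bullet> b) = C"
        unfolding C_def using True by (intro prod.cong) (auto simp: inner_diff_left split: if_splits)
      finally show ?thesis
        using i by (simp add: inner_diff_left mult.commute)
    next
      case False
      then have "measure lborel (cbox ?l ?u) = 0"
        by (simp only: measure_lborel_cbox_eq if_False)
      then show ?thesis
        using C0 that by simp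
    qed
    moreover have "0 \<le> measure lborel ?D" by simp
    ultimately show ?thesis by linarith
  qed
  have "C-lipschitz_on UNIV f"
  proof (rule lipschitz_onI)
    fix x y :: real
    show "dist (f x) (f y) \<le> C * dist x y"
      using lip[of x y] lip[of y x] C0 by (cases "x \<le> y") (auto simp: dist_real_def)
  qed (fact C0)
  then have cont: "continuous_on UNIV f"
    by (rule lipschitz_on_continuous_on)
  \<comment> \<open>\<open>min\<close> and \<open>max\<close> are there because an empty enclosing
    box may have its corners in the wrong order.\<close>
  have lo: "f (min (l \<bullet> i) (u \<bullet> i) - 1) = measure lborel S"
    unfolding f_def using lu i by (intro arg_cong[where f = "measure lborel"]) (force simp: cbox_def)
  have hi: "f (max (l \<bullet> i) (u \<bullet> i) + 1) = 0"
  proof -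
    have "S \<inter> {x. max (l \<bullet> i) (u \<bullet> i) + 1 < x \<bullet> i} = {}"
      using lu i by (force simp: cbox_def)
    then show ?thesis unfolding f_def by simp
  qed
  have "\<exists>c. min (l \<bullet> i) (u \<bullet> i) - 1 \<le> c \<and> c \<le> max (l \<bullet> i) (u \<bullet> i) + 1 \<and> f c = t"
    by (rule IVT2') (use t lo hi cont in \<open>auto intro: continuous_on_subset\<close>)
  then show ?thesis unfolding f_def by auto
qed

section \<open>Equal-volume Brunn-Minkowski for finite unions of boxes\<close>

text \<open>Nonempty open boxes have positive volume, and two disjoint ones are separated by a
  coordinate hyperplane. Both facts drive the induction on the number of boxes.\<close>

definition box_family :: "'a::euclidean_space set set \<Rightarrow> bool" where
  "box_family \<A> \<longleftrightarrow> finite \<A> \<and> disjoint \<A> \<and> (\<forall>K\<in>\<A>. K \<noteq> {} \<and> (\<exists>a b. K = box a b))"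

definition convex_comb :: "real \<Rightarrow> 'a::real_vector set \<Rightarrow> 'a set \<Rightarrow> 'a set" where
  "convex_comb l X Y = (\<lambda>(x, y). l *\<^sub>R x + (1 - l) *\<^sub>R y) ` (X \<times> Y)"

lemma convex_comb_swap: "convex_comb l X Y = convex_comb (1 - l) Y X"
  unfolding convex_comb_def by (force simp: add.commute)

lemma open_convex_comb:
  fixes X :: "'a::real_normed_vector set"
  assumes "open X" "l \<noteq> 0"
  shows "open (convex_comb l X Y)"
proof -
  have "convex_comb l X Y = (\<Union>y\<in>Y. (\<lambda>x. (1 - l) *\<^sub>R y + l *\<^sub>R x) ` X)"
    unfolding convex_comb_def by (force simp: add.commute)
  then show ?thesis
    using open_affinity[OF assms] by auto
qed

lemma bounded_convex_comb:
  fixes X :: "'a::real_normed_vector set"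
  assumes "bounded X" "bounded Y"
  shows "bounded (convex_comb l X Y)"
proof -
  have "bounded ((\<lambda>z. l *\<^sub>R fst z + (1 - l) *\<^sub>R snd z) ` (X \<times> Y))"
    by (intro bounded_plus_comp bounded_scaleR_comp bounded_fst bounded_snd
      bounded_linear_image[of _ fst] bounded_linear_image[of _ snd] bounded_Times assms
      bounded_linear_fst bounded_linear_snd)
  then show ?thesis
    unfolding convex_comb_def by (simp add: case_prod_unfold)
qed

lemma box_family_open: "box_family \<A> \<Longrightarrow> open (\<Union>\<A>)"
  unfolding box_family_def by (intro open_Union) auto

lemma box_family_bounded: "box_family \<A> \<Longrightarrow> bounded (\<Union>\<A>)"
  unfolding box_family_def by (intro bounded_Union) auto

text \<open>Cutting by a half-space keeps at most one piece per box, and empty pieces are discarded.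
  A box that misses the half-space makes the count drop strictly, which is what makes the induction
  terminate.\<close>

lemma box_family_restrict:
  assumes "box_family \<A>" and H: "\<And>a b. \<exists>a' b'. box a b \<inter> H = box a' b'"
  defines "\<B> \<equiv> (\<lambda>K. K \<inter> H) ` \<A> - {{}}"
  shows "box_family \<B>" "\<Union>\<B> = \<Union>\<A> \<inter> H" "card \<B> \<le> card \<A>"
    "K \<in> \<A> \<Longrightarrow> K \<inter> H = {} \<Longrightarrow> card \<B> < card \<A>"
proof -
  have fin: "finite \<A>" using assms by (auto simp: box_family_def)
  have "\<exists>a b. K = box a b" if "K \<in> \<B>" for K
    using that assms(1) H unfolding box_family_def \<B>_def by (metis DiffD1 imageE)
  moreover have "disjoint \<B>"
    using assms(1) unfolding box_family_def \<B>_def disjoint_def by blast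
  ultimately show "box_family \<B>"
    using fin unfolding box_family_def by (auto simp: \<B>_def)
  show "\<Union>\<B> = \<Union>\<A> \<inter> H" unfolding \<B>_def by auto
  show "card \<B> \<le> card \<A>"
    unfolding \<B>_def using fin by (meson card_Diff1_le card_image_le finite_imageI order_trans)
  show "card \<B> < card \<A>" if "K \<in> \<A>" "K \<inter> H = {}"
  proof -
    have "\<B> \<subseteq> (\<lambda>K. K \<inter> H) ` (\<A> - {K})"
      using that unfolding \<B>_def by auto
    then have "card \<B> \<le> card (\<A> - {K})"
      using fin by (meson card_image_le card_mono finite_Diff finite_imageI order_trans)
    also have "\<dots> < card \<A>"
      using fin that by (meson card_Diff1_less)
    finally show ?thesis .
  qed
qed

lemma box_family_measure_pos:
  assumes "box_family \<A>" "K \<in> \<A>" "K \<subseteq> S" "S \<in> fmeasurable lborel"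
  shows "0 < measure lborel S"
proof -
  obtain a b where K: "K = box a b" "box a b \<noteq> {}"
    using assms unfolding box_family_def by metis
  then have "0 < measure lborel K"
    by (auto simp: measure_lborel_box_eq box_ne_empty inner_diff_left less_imp_le intro!: prod_pos)
  also have "\<dots> \<le> measure lborel S"
    using assms K by (intro measure_mono_fmeasurable) auto
  finally show ?thesis .
qed

text \<open>The combination contains the box whose side lengths are the weighted means of the given
  ones. By the weighted inequality of arithmetic and geometric means its volume is at least
  \<open>P powr l * P powr (1 - l)\<close>, where \<open>P\<close> is the common volume.\<close>

lemma measure_convex_comb_boxes:
  fixes a b a' b' :: "'a::euclidean_space"
  assumes l: "0 < l" "l < 1" and ne: "box a b \<noteq> {}" "box a' b' \<noteq> {}"
    and eq: "measure lborel (box a b) = measure lborel (box a' b')"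
  shows "measure lborel (box a b) \<le> measure lborel (convex_comb l (box a b) (box a' b'))"
proof -
  let ?p = "l *\<^sub>R a + (1 - l) *\<^sub>R a'" and ?q = "l *\<^sub>R b + (1 - l) *\<^sub>R b'"
  have lt: "a \<bullet> j < b \<bullet> j" "a' \<bullet> j < b' \<bullet> j" if "j \<in> Basis" for j
    using ne that by (auto simp: box_ne_empty)
  have pq: "?p \<bullet> j < ?q \<bullet> j" if "j \<in> Basis" for j
    using lt[OF that] l by (simp add: inner_add_left add_strict_mono)
  have sub: "box ?p ?q \<subseteq> convex_comb l (box a b) (box a' b')"
  proof
    fix x assume x: "x \<in> box ?p ?q"
    \<comment> \<open>The relative position of \<open>x\<close> in the combined box. The points
      \<open>y\<close> and \<open>z\<close> at the same relative position in the two given boxes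
      combine to \<open>x\<close>.\<close>
    define t where "t j = (x \<bullet> j - ?p \<bullet> j) / (?q \<bullet> j - ?p \<bullet> j)" for j
    have t: "0 < t j" "t j < 1" if "j \<in> Basis" for j
      using x pq[OF that] that unfolding t_def by (auto simp: box_def)
    have tx: "x \<bullet> j = ?p \<bullet> j + t j * (?q \<bullet> j - ?p \<bullet> j)" if "j \<in> Basis" for j
      using pq[OF that] unfolding t_def by simp
    define y where "y = (\<Sum>j\<in>Basis. (a \<bullet> j + t j * (b \<bullet> j - a \<bullet> j)) *\<^sub>R j)"
    define z where "z = (\<Sum>j\<in>Basis. (a' \<bullet> j + t j * (b' \<bullet> j - a' \<bullet> j)) *\<^sub>R j)"
    have aux: "u < u + s * (v - u) \<and> u + s * (v - u) < v" if "0 < s" "s < 1" "u < v" for u v s :: real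
    proof -
      have "0 < s * (v - u)" "0 < (1 - s) * (v - u)" using that by auto
      then show ?thesis by (simp add: algebra_simps)
    qed
    have "y \<in> box a b" "z \<in> box a' b'"
      unfolding y_def z_def box_def using aux t lt by auto
    moreover have "x = l *\<^sub>R y + (1 - l) *\<^sub>R z"
    proof (rule euclidean_eqI)
      fix j :: 'a assume j: "j \<in> Basis"
      have "y \<bullet> j = a \<bullet> j + t j * (b \<bullet> j - a \<bullet> j)" "z \<bullet> j = a' \<bullet> j + t j * (b' \<bullet> j - a' \<bullet> j)"
        using j by (simp_all add: y_def z_def)
      then show "x \<bullet> j = (l *\<^sub>R y + (1 - l) *\<^sub>R z) \<bullet> j"
        by (simp only: tx[OF j] inner_add_left inner_scaleR_left) (simp add: algebra_simps)
    qed
    ultimately show "x \<in> convex_comb l (box a b) (box a' b')"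
      unfolding convex_comb_def by auto
  qed
  have op: "open (convex_comb l (box a b) (box a' b'))"
    using l by (intro open_convex_comb) auto
  have bd: "bounded (convex_comb l (box a b) (box a' b'))"
    by (intro bounded_convex_comb) auto
  define P where "P = (\<Prod>j\<in>Basis. (b - a) \<bullet> j)"
  have P: "P > 0" unfolding P_def using lt by (intro prod_pos) (auto simp: inner_diff_left)
  have m1: "measure lborel (box a b) = P"
    unfolding P_def using lt by (auto simp: measure_lborel_box_eq less_imp_le)
  have m2: "P = (\<Prod>j\<in>Basis. (b' - a') \<bullet> j)"
    using eq lt unfolding m1 by (auto simp: measure_lborel_box_eq less_imp_le)
  have "P = P powr l * P powr (1 - l)"
    using P by (simp flip: powr_add)
  also have "P powr l = (\<Prod>j\<in>Basis. ((b - a) \<bullet> j) powr l)"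
    unfolding P_def using lt by (simp add: prod_powr_distrib inner_diff_left less_imp_le)
  also have "P powr (1 - l) = (\<Prod>j\<in>Basis. ((b' - a') \<bullet> j) powr (1 - l))"
    unfolding m2 using lt by (simp add: prod_powr_distrib inner_diff_left less_imp_le)
  also have "(\<Prod>j\<in>Basis. ((b - a) \<bullet> j) powr l) * (\<Prod>j\<in>Basis. ((b' - a') \<bullet> j) powr (1 - l))
      = (\<Prod>j\<in>Basis. ((b - a) \<bullet> j) powr l * ((b' - a') \<bullet> j) powr (1 - l))"
    by (simp add: prod.distrib)
  also have "\<dots> \<le> (\<Prod>j\<in>Basis. (?q - ?p) \<bullet> j)"
  proof (rule prod_mono, safe)
    fix j :: 'a assume j: "j \<in> Basis"
    show "((b - a) \<bullet> j) powr l * ((b' - a') \<bullet> j) powr (1 - l) \<le> (?q - ?p) \<bullet> j"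
      using Youngs_inequality_0[of l "1 - l" "(b - a) \<bullet> j" "(b' - a') \<bullet> j"] l lt[OF j]
      by (simp add: inner_diff_left inner_add_left algebra_simps)
  qed simp
  also have "\<dots> = measure lborel (box ?p ?q)"
    using pq by (subst measure_lborel_box_eq) (auto simp: less_imp_le)
  also have "\<dots> \<le> measure lborel (convex_comb l (box a b) (box a' b'))"
    using sub op bd by (intro measure_mono_fmeasurable bounded_open_fmeasurable) auto
  finally show ?thesis using m1 by simp
qed

text \<open>The induction of Hadwiger and Ohmann: a hyperplane cuts the first family between two of its
  boxes, and a parallel hyperplane cuts the second family into parts of the same volumes.\<close>

lemma measure_convex_comb_box_families:
  fixes \<A> \<B> :: "'a::euclidean_space set set"
  assumes "box_family \<A>" "box_family \<B>" "\<A> \<noteq> {}" "\<B> \<noteq> {}"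
    and "measure lborel (\<Union>\<A>) = measure lborel (\<Union>\<B>)" "0 < l" "l < 1"
  shows "measure lborel (\<Union>\<A>) \<le> measure lborel (convex_comb l (\<Union>\<A>) (\<Union>\<B>))"
  using assms
proof (induction "card \<A> + card \<B>" arbitrary: \<A> \<B> l rule: less_induct)
  case less
  show ?case
  proof (cases "card \<A> = 1 \<and> card \<B> = 1")
    case True
    then obtain K L where "\<A> = {K}" "\<B> = {L}"
      by (meson card_1_singletonE)
    moreover from this have "\<exists>a b. K = box a b" "\<exists>a b. L = box a b" "K \<noteq> {}" "L \<noteq> {}"
      using less.prems by (auto simp: box_family_def)
    then obtain a b a' b' where "K = box a b" "L = box a' b'" "K \<noteq> {}" "L \<noteq> {}"
      by metis
    ultimately show ?thesis
      using less.prems measure_convex_comb_boxes[of l a b a' b'] by simp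
  next
    case False
    \<comment> \<open>Stated for an arbitrary pair with the same total count, so that whichever
      family has several boxes can be the one that is cut; exchanging the families replaces
      \<open>l\<close> by \<open>1 - l\<close>.\<close>
    have split: "measure lborel (\<Union>\<C>) \<le> measure lborel (convex_comb t (\<Union>\<C>) (\<Union>\<D>))"
      if hyps: "box_family \<C>" "box_family \<D>" "\<C> \<noteq> {}" "\<D> \<noteq> {}"
        "measure lborel (\<Union>\<C>) = measure lborel (\<Union>\<D>)" "0 < t" "t < 1"
        "card \<C> + card \<D> = card \<A> + card \<B>" "card \<C> \<noteq> 1" for \<C> \<D> :: "'a set set" and t
    proof -
      have fin: "finite \<C>" "finite \<D>" using hyps by (auto simp: box_family_def)
      have "1 < card \<C>"
        using hyps(3,9) fin by (metis card_0_eq less_one linorder_neqE_nat)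
      then obtain K L where KL: "K \<in> \<C>" "L \<in> \<C>" "K \<noteq> L"
        using fin by (metis card_le_Suc0_iff_eq leD One_nat_def)
      then have dis: "K \<inter> L = {}" "K \<noteq> {}" "L \<noteq> {}"
        using hyps(1) by (auto simp: box_family_def disjoint_def)
      obtain a b where K: "K = box a b" using hyps(1) KL unfolding box_family_def by metis
      obtain a' b' where L: "L = box a' b'" using hyps(1) KL unfolding box_family_def by metis
      have lt: "a \<bullet> j < b \<bullet> j" "a' \<bullet> j < b' \<bullet> j" if "j \<in> Basis" for j
        using dis that unfolding K L by (auto simp: box_ne_empty)
      obtain i where i: "i \<in> Basis" "b \<bullet> i \<le> a' \<bullet> i \<or> b' \<bullet> i \<le> a \<bullet> i"
        using dis(1) lt unfolding K L disjoint_interval(4) by (meson not_le)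
      have "\<exists>c. K \<subseteq> {x. x \<bullet> i < c} \<and> L \<subseteq> {x. c < x \<bullet> i} \<or>
          L \<subseteq> {x. x \<bullet> i < c} \<and> K \<subseteq> {x. c < x \<bullet> i}"
        using i(2)
      proof
        assume "b \<bullet> i \<le> a' \<bullet> i"
        then show ?thesis
          unfolding K L using i(1) by (intro exI[of _ "b \<bullet> i"] disjI1) (fastforce simp: box_def)
      next
        assume "b' \<bullet> i \<le> a \<bullet> i"
        then show ?thesis
          unfolding K L using i(1) by (intro exI[of _ "b' \<bullet> i"] disjI2) (fastforce simp: box_def)
      qed
      then obtain c where c: "K \<subseteq> {x. x \<bullet> i < c} \<and> L \<subseteq> {x. c < x \<bullet> i} \<or>
          L \<subseteq> {x. x \<bullet> i < c} \<and> K \<subseteq> {x. c < x \<bullet> i}" ..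
      define G where "G = {x. c < x \<bullet> i}"
      define G' where "G' = {x. x \<bullet> i < c}"
      have opG: "open G" "open G'"
        unfolding G_def G'_def by (auto intro!: open_Collect_less continuous_intros)
      have disGG': "G \<inter> G' = {}" unfolding G_def G'_def by auto
      define \<C>1 where "\<C>1 = (\<lambda>K. K \<inter> G) ` \<C> - {{}}"
      define \<C>2 where "\<C>2 = (\<lambda>K. K \<inter> G') ` \<C> - {{}}"
      have repr: "\<exists>a' b'. box a b \<inter> {x. c < x \<bullet> i} = box a' b'"
        "\<exists>a' b'. box a b \<inter> {x. x \<bullet> i < c} = box a' b'" for a b :: 'a and c
        using box_Int_greaterThan[OF i(1)] box_Int_lessThan[OF i(1)] by blast+
      note r1 = box_family_restrict[OF hyps(1) repr(1)[of _ _ c], folded G_def, folded \<C>1_def]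
      note r2 = box_family_restrict[OF hyps(1) repr(2)[of _ _ c], folded G'_def, folded \<C>2_def]
      have exG: "\<exists>K\<in>\<C>. K \<noteq> {} \<and> K \<subseteq> G" "\<exists>K\<in>\<C>. K \<noteq> {} \<and> K \<subseteq> G'"
        using c KL dis unfolding G_def G'_def by blast+
      have less1: "card \<C>1 < card \<C>" "card \<C>2 < card \<C>"
        using r1(4) r2(4) exG disGG' by blast+
      have bC: "bounded (\<Union>\<C>)" "open (\<Union>\<C>)" and bD: "bounded (\<Union>\<D>)" "open (\<Union>\<D>)"
        using hyps(1,2) by (simp_all only: box_family_open box_family_bounded)
      have fmC: "\<Union>\<C> \<inter> G \<in> fmeasurable lborel" "\<Union>\<C> \<inter> G' \<in> fmeasurable lborel"
        using bC opG by (auto intro!: bounded_open_fmeasurable)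
      have posC: "0 < measure lborel (\<Union>\<C> \<inter> G)" "0 < measure lborel (\<Union>\<C> \<inter> G')"
        using exG box_family_measure_pos[OF hyps(1)] fmC by (metis Int_greatest Sup_upper)+
      have i0: "i \<noteq> 0" using i by auto
      have sumC: "measure lborel (\<Union>\<C>) = measure lborel (\<Union>\<C> \<inter> G) + measure lborel (\<Union>\<C> \<inter> G')"
        unfolding G_def G'_def using bC i0 by (intro measure_hyperplane_cut) auto
      obtain c' where c': "measure lborel (\<Union>\<D> \<inter> {x. c' < x \<bullet> i}) = measure lborel (\<Union>\<C> \<inter> G)"
        using exists_hyperplane_cut[of "\<Union>\<D>" i "measure lborel (\<Union>\<C> \<inter> G)"] bD i sumC hyps(5)
        by (auto simp: measure_nonneg)
      define F where "F = {x. c' < x \<bullet> i}"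
      define F' where "F' = {x. x \<bullet> i < c'}"
      define \<D>1 where "\<D>1 = (\<lambda>K. K \<inter> F) ` \<D> - {{}}"
      define \<D>2 where "\<D>2 = (\<lambda>K. K \<inter> F') ` \<D> - {{}}"
      note s1 = box_family_restrict[OF hyps(2) repr(1)[of _ _ c'], folded F_def, folded \<D>1_def]
      note s2 = box_family_restrict[OF hyps(2) repr(2)[of _ _ c'], folded F'_def, folded \<D>2_def]
      have sumD: "measure lborel (\<Union>\<D>) = measure lborel (\<Union>\<D> \<inter> F) + measure lborel (\<Union>\<D> \<inter> F')"
        unfolding F_def F'_def using bD i0 by (intro measure_hyperplane_cut) auto
      have eq1: "measure lborel (\<Union>\<C>1) = measure lborel (\<Union>\<D>1)"
        using c' r1(2) s1(2) unfolding F_def by simp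
      have eq2: "measure lborel (\<Union>\<C>2) = measure lborel (\<Union>\<D>2)"
        using eq1 sumC sumD hyps(5) r1(2) r2(2) s1(2) s2(2) by simp
      have ne: "\<C>1 \<noteq> {}" "\<C>2 \<noteq> {}" "\<D>1 \<noteq> {}" "\<D>2 \<noteq> {}"
        using posC eq1 eq2 r1(2) r2(2) by auto
      let ?M1 = "convex_comb t (\<Union>\<C>1) (\<Union>\<D>1)" and ?M2 = "convex_comb t (\<Union>\<C>2) (\<Union>\<D>2)"
        and ?M = "convex_comb t (\<Union>\<C>) (\<Union>\<D>)"
      have IH1: "measure lborel (\<Union>\<C>1) \<le> measure lborel ?M1"
        by (rule less.hyps[OF _ r1(1) s1(1) ne(1) ne(3) eq1 hyps(6,7)])
          (use less1 s1(3) hyps(8) in linarith)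
      have IH2: "measure lborel (\<Union>\<C>2) \<le> measure lborel ?M2"
        by (rule less.hyps[OF _ r2(1) s2(1) ne(2) ne(4) eq2 hyps(6,7)])
          (use less1 s2(3) hyps(8) in linarith)
      have bO: "bounded (\<Union>\<C>1)" "bounded (\<Union>\<C>2)" "bounded (\<Union>\<D>1)" "bounded (\<Union>\<D>2)"
         "open (\<Union>\<C>1)" "open (\<Union>\<C>2)"
        using r1(1) r2(1) s1(1) s2(1) by (simp_all only: box_family_open box_family_bounded)
      have fmM: "?M1 \<in> fmeasurable lborel" "?M2 \<in> fmeasurable lborel" "?M \<in> fmeasurable lborel"
        using bO bC bD hyps by (auto intro!: bounded_open_fmeasurable bounded_convex_comb open_convex_comb)
      \<comment> \<open>The combinations of upper parts and of lower parts lie strictly on opposite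
        sides of the hyperplane at the combined height. They are disjoint, so their volumes add
        up.\<close>
      have side1: "?M1 \<subseteq> {x. t * c + (1 - t) * c' < x \<bullet> i}"
        using hyps(6,7) unfolding r1(2) s1(2) G_def F_def convex_comb_def
        by (auto simp: inner_add_left intro!: add_strict_mono)
      have side2: "?M2 \<subseteq> {x. x \<bullet> i < t * c + (1 - t) * c'}"
        using hyps(6,7) unfolding r2(2) s2(2) G'_def F'_def convex_comb_def
        by (auto simp: inner_add_left intro!: add_strict_mono)
      have "measure lborel (\<Union>\<C>) \<le> measure lborel ?M1 + measure lborel ?M2"
        using IH1 IH2 sumC r1(2) r2(2) by simp
      also have "\<dots> = measure lborel (?M1 \<union> ?M2)"
        using fmM side1 side2 by (intro measure_Union[symmetric]) (auto simp: fmeasurable_def, fastforce)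
      also have "\<dots> \<le> measure lborel ?M"
      proof (rule measure_mono_fmeasurable)
        show "?M1 \<union> ?M2 \<subseteq> ?M"
          by (auto simp: r1(2) r2(2) s1(2) s2(2) convex_comb_def)
      next
        show "?M1 \<union> ?M2 \<in> sets lborel"
          using fmM by (intro sets.Un fmeasurableD)
      qed (fact fmM)
      finally show ?thesis .
    qed
    show ?thesis
    proof (cases "card \<A> = 1")
      case False
      then show ?thesis using split[of \<A> \<B> l] less.prems by simp
    next
      case True
      then show ?thesis using split[of \<B> \<A> "1 - l"] less.prems False convex_comb_swap[of l "\<Union>\<A>" "\<Union>\<B>"]
        by simp
    qed
  qed
qed

section \<open>Slabs through a symmetric convex set\<close>

lemma uminus_image_eq_vimage: "uminus ` S = uminus -` (S :: 'a::group_add set)"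
  by (auto simp: image_iff) (metis minus_minus)

lemma measure_uminus_image:
  fixes S :: "'a::euclidean_space set"
  assumes "S \<in> sets borel"
  shows "measure lborel (uminus ` S) = measure lborel S"
proof -
  have "uminus ` S \<in> sets borel"
    unfolding uminus_image_eq_vimage
    using measurable_sets[of uminus borel borel S] assms by simp
  then show ?thesis
    using measure_lebesgue_affine[of "-1" 0 S] assms by simp
qed

text \<open>An open set is a countable union of closed boxes, and finitely many of them exhaust its
  volume up to \<open>e\<close>. A division refines these to nonoverlapping boxes, whose interiors
  omit only a null set of boundary points.\<close>

lemma open_box_family_approx:
  fixes U :: "'a::euclidean_space set"
  assumes U: "open U" "bounded U" and e: "e > 0"
  obtains \<A> where "box_family \<A>" "\<Union>\<A> \<subseteq> U" "measure lborel U - e < measure lborel (\<Union>\<A>)"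
proof -
  obtain \<D> where D: "countable \<D>" "\<D> \<subseteq> Pow U" "\<And>X. X \<in> \<D> \<Longrightarrow> \<exists>a b. X = cbox a b" "\<Union>\<D> = U"
    using open_countable_Union_open_cbox U by metis
  have U_meas: "U \<in> lmeasurable"
    using U by (intro lmeasurable_open)
  have "measure lebesgue (\<Union>D') \<le> measure lebesgue U" if D': "D' \<subseteq> \<D>" "finite D'" for D'
  proof (intro measure_mono_fmeasurable)
    show "\<Union>D' \<subseteq> U" using D' D(2) by auto
    show "\<Union>D' \<in> sets lebesgue"
      using D' D(3) by (intro sets.finite_Union) (auto, metis lmeasurable_cbox fmeasurableD subsetD)
  qed fact
  then obtain D' where D': "D' \<subseteq> \<D>" "finite D'" "measure lebesgue (\<Union>\<D>) - e < measure lebesgue (\<Union>D')"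
    using measure_countable_Union_approachable[OF D(1) e, of "measure lebesgue U"] D(3)
    by (metis lmeasurable_cbox)
  obtain p where p: "p division_of (\<Union>D')"
    using elementary_unions_intervals[OF D'(2)] D'(1) D(3) by (metis subsetD)
  define \<A> where "\<A> = interior ` p - {{}}"
  have fam: "box_family \<A>"
    unfolding box_family_def
  proof (intro conjI ballI)
    show "finite \<A>" using p unfolding \<A>_def by auto
    show "disjoint \<A>"
      unfolding \<A>_def disjoint_def using division_ofD(5)[OF p] by blast
    show "K \<noteq> {}" if "K \<in> \<A>" for K using that unfolding \<A>_def by auto
    show "\<exists>a b. K = box a b" if "K \<in> \<A>" for K
      using that division_ofD(4)[OF p] unfolding \<A>_def by (auto; metis interior_cbox)
  qed
  have sub: "\<Union>\<A> \<subseteq> \<Union>D'"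
    using division_ofD(6)[OF p] interior_subset unfolding \<A>_def by fastforce
  have "negligible (\<Union>K\<in>p. K - interior K)"
  proof (rule negligible_Union)
    show "finite ((\<lambda>K. K - interior K) ` p)" using division_ofD(1)[OF p] by simp
    fix T assume "T \<in> (\<lambda>K. K - interior K) ` p"
    then obtain a b where "T = cbox a b - box a b"
      using division_ofD(4)[OF p] by (metis (no_types, lifting) imageE interior_cbox)
    then show "negligible T" by (simp add: negligible_frontier_interval)
  qed
  moreover have "(\<Union>\<A> - \<Union>D') \<union> (\<Union>D' - \<Union>\<A>) \<subseteq> (\<Union>K\<in>p. K - interior K)"
    using sub unfolding division_ofD(6)[OF p, symmetric] \<A>_def by blast
  ultimately have "negligible ((\<Union>\<A> - \<Union>D') \<union> (\<Union>D' - \<Union>\<A>))"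
    by (rule negligible_subset)
  then have "measure lebesgue (\<Union>D') = measure lebesgue (\<Union>\<A>)"
    using fam by (intro measure_negligible_symdiff lmeasurable_open box_family_open box_family_bounded)
  then have "measure lborel U - e < measure lborel (\<Union>\<A>)"
    using D'(3) D(4) U(1) box_family_open[OF fam] by simp
  moreover have "\<Union>\<A> \<subseteq> U" using sub D'(1) D(4) by auto
  ultimately show thesis using fam that by blast
qed

lemma measure_convex_comb_uminus:
  fixes U W :: "'a::euclidean_space set"
  assumes U: "open U" "bounded U" and l: "0 < l" "l < 1"
    and W: "W \<in> fmeasurable lborel" "convex_comb l U (uminus ` U) \<subseteq> W"
  shows "measure lborel U \<le> measure lborel W"
proof (rule field_le_epsilon)
  fix e :: real assume "e > 0"
  then obtain \<A> where A: "box_family \<A>" "\<Union>\<A> \<subseteq> U" "measure lborel U - e < measure lborel (\<Union>\<A>)"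
    using open_box_family_approx[OF U] by metis
  have "measure lborel (\<Union>\<A>) \<le> measure lborel W"
  proof (cases "\<A> = {}")
    case False
    define \<B> where "\<B> = (`) uminus ` \<A>"
    have "uminus ` box a b = box (- b) (- a)" for a b :: 'a
      unfolding uminus_image_eq_vimage by (auto simp: box_def minus_less_iff less_minus_iff)
    then have "\<exists>a b. K = box a b" if "K \<in> \<B>" for K
      using that A(1) unfolding box_family_def \<B>_def by (metis imageE)
    moreover have "disjoint \<B>"
      using A(1) unfolding box_family_def \<B>_def by (intro disjoint_image) auto
    ultimately have "box_family \<B>"
      using A(1) unfolding box_family_def by (auto simp: \<B>_def)
    moreover have UB: "\<Union>\<B> = uminus ` \<Union>\<A>" unfolding \<B>_def by auto
    moreover have "measure lborel (\<Union>\<A>) = measure lborel (\<Union>\<B>)"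
      unfolding UB using box_family_open[OF A(1)] by (intro measure_uminus_image[symmetric]) auto
    ultimately have "measure lborel (\<Union>\<A>) \<le> measure lborel (convex_comb l (\<Union>\<A>) (\<Union>\<B>))"
      using A(1) False l by (intro measure_convex_comb_box_families) (auto simp: \<B>_def)
    also have "\<dots> \<le> measure lborel W"
    proof (rule measure_mono_fmeasurable)
      show "convex_comb l (\<Union>\<A>) (\<Union>\<B>) \<subseteq> W"
        using W(2) A(2) unfolding UB convex_comb_def by blast
      show "convex_comb l (\<Union>\<A>) (\<Union>\<B>) \<in> sets lborel"
        using open_convex_comb[OF box_family_open[OF A(1)], of l] l by simp
    qed fact
    finally show ?thesis .
  qed simp
  then show "measure lborel U \<le> measure lborel W + e" using A by simp
qed

text \<open>Suitably combined with its own mirror image, the outer layer, where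
  \<open>a \<bullet> x\<close> lies between \<open>r\<close> and \<open>r + h\<close>, falls into
  the inner layer between \<open>r - h\<close> and \<open>r\<close>. Hence the outer layer is no
  larger than the inner one, and the symmetry of \<open>C\<close> doubles both.\<close>

lemma measure_slab_midpoint_concave:
  fixes C :: "'a::euclidean_space set"
  assumes C: "open C" "convex C" "uminus ` C = C"
    and bdd: "\<And>r. bounded (C \<inter> {x. \<bar>a \<bullet> x\<bar> < r})"
    and a: "a \<noteq> 0" and h: "0 < h" "h < r"
  defines "V \<equiv> \<lambda>r. measure lborel (C \<inter> {x. \<bar>a \<bullet> x\<bar> < r})"
  shows "V (r + h) + V (r - h) \<le> 2 * V r"
proof -
  define E where "E s t = C \<inter> {x. s < x \<bullet> a \<and> x \<bullet> a < t}" for s t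
  have openE: "open (E s t)" for s t
    unfolding E_def using C
    by (intro open_Int) (auto intro!: open_Collect_conj open_Collect_less continuous_intros)
  have "E s t \<subseteq> C \<inter> {x. \<bar>a \<bullet> x\<bar> < \<bar>s\<bar> + \<bar>t\<bar>}" for s t
    unfolding E_def by (auto simp: inner_commute)
  then have bddE: "bounded (E s t)" for s t
    using bdd bounded_subset by blast
  have V: "V r = measure lborel (E (-r) r)" for r
    unfolding V_def E_def by (intro arg_cong[where f = "measure lborel"]) (auto simp: inner_commute)
  have split: "measure lborel (E s u) = measure lborel (E s t) + measure lborel (E t u)"
    if "s < t" "t < u" for s t u
  proof -
    have "E s u \<inter> {x. t < x \<bullet> a} = E t u" "E s u \<inter> {x. x \<bullet> a < t} = E s t"
      using that unfolding E_def by auto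
    then show ?thesis
      using measure_hyperplane_cut[of "E s u" a t] openE bddE a by simp
  qed
  have minus: "measure lborel (E (-t) (-s)) = measure lborel (E s t)" for s t
  proof -
    have "uminus ` E s t = E (-t) (-s)"
    proof
      show "uminus ` E s t \<subseteq> E (-t) (-s)"
        using C(3) unfolding E_def by auto
      show "E (-t) (-s) \<subseteq> uminus ` E s t"
      proof
        fix x assume "x \<in> E (-t) (-s)"
        then have "- x \<in> E s t"
          using C(3) unfolding E_def by auto
        then show "x \<in> uminus ` E s t" by force
      qed
    qed
    then show ?thesis
      using measure_uminus_image[of "E s t"] openE[of s t] by simp
  qed
  have diff: "V t = V s + 2 * measure lborel (E s t)" if "0 < s" "s < t" for s t
    using split[of "-t" "-s" t] split[of "-s" s t] minus[of t s] that unfolding V by simp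
  \<comment> \<open>The weight solves \<open>l * r - (1 - l) * (r + h) = r - h\<close>. The upper
    ends then match as well, since both layers have width \<open>h\<close>.\<close>
  define l where "l = 2 * r / (2 * r + h)"
  have l: "0 < l" "l < 1" unfolding l_def using h by (auto simp: field_simps)
  have "l * (2 * r + h) = 2 * r" unfolding l_def using h by simp
  then have l_lo: "l * r - (1 - l) * (r + h) = r - h" and l_hi: "l * (r + h) - (1 - l) * r = r"
    by (simp_all add: algebra_simps)
  have "measure lborel (E r (r + h)) \<le> measure lborel (E (r - h) r)"
  proof (rule measure_convex_comb_uminus[OF openE bddE l])
    show "E (r - h) r \<in> fmeasurable lborel"
      using openE bddE by (intro bounded_open_fmeasurable)
    show "convex_comb l (E r (r + h)) (uminus ` E r (r + h)) \<subseteq> E (r - h) r"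
    proof
      fix z assume "z \<in> convex_comb l (E r (r + h)) (uminus ` E r (r + h))"
      then obtain x y where z: "z = l *\<^sub>R x + (1 - l) *\<^sub>R (- y)" and xy: "x \<in> E r (r + h)" "y \<in> E r (r + h)"
        unfolding convex_comb_def by auto
      have "- y \<in> C" using xy C(3) unfolding E_def by auto
      then have "z \<in> C"
        using xy l C(2) unfolding z E_def by (intro convexD) auto
      moreover have az: "z \<bullet> a = l * (x \<bullet> a) - (1 - l) * (y \<bullet> a)"
        unfolding z by (simp add: inner_diff_left)
      have "l * r - (1 - l) * (r + h) < z \<bullet> a" "z \<bullet> a < l * (r + h) - (1 - l) * r"
        unfolding az using xy l unfolding E_def by (auto intro!: diff_strict_mono)
      ultimately have "z \<in> C" "r - h < z \<bullet> a" "z \<bullet> a < r"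
        unfolding l_lo l_hi by simp_all
      then show "z \<in> E (r - h) r"
        unfolding E_def by simp
    qed
  qed
  then show ?thesis
    using diff[of r "r + h"] diff[of "r - h" r] h by simp
qed

section \<open>Monotone midpoint-concave functions of one variable\<close>

text \<open>On an arithmetic progression midpoint concavity says that increments decrease. A
  progression through \<open>z\<close> with \<open>N\<close> steps up to \<open>y\<close> need not
  hit \<open>x\<close>; monotonicity absorbs the last incomplete step, whose cost vanishes as
  \<open>N\<close> grows.\<close>

lemma midpoint_concave_slope_le:
  fixes f :: "real \<Rightarrow> real"
  assumes mono: "\<And>x y. 0 < x \<Longrightarrow> x \<le> y \<Longrightarrow> f x \<le> f y"
    and mid: "\<And>x h. 0 < h \<Longrightarrow> h < x \<Longrightarrow> f (x + h) + f (x - h) \<le> 2 * f x"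
    and xyz: "0 < x" "x < z" "z < y"
  shows "(f y - f z) / (y - z) \<le> (f z - f x) / (z - x)"
proof -
  have step: "f (t + real k * h) - f t \<le> real k * (f (t + h) - f t)" if "0 < t" "0 < h" for t h k
  proof (induction k)
    case (Suc k)
    have inc: "f (t + real j * h + h) - f (t + real j * h) \<le> f (t + h) - f t" for j
    proof (induction j)
      case (Suc j)
      have "h < t + real j * h + h" using that by (simp add: add_pos_nonneg)
      then show ?case
        using Suc mid[of h "t + real j * h + h"] that by (simp add: algebra_simps)
    qed simp
    show ?case using Suc inc[of k] by (simp add: algebra_simps)
  qed simp
  have step': "real k * (f (t + h) - f t) \<le> f t - f (t - real k * h)" if "0 < t - real k * h" "0 < h" for t h k
    using that
  proof (induction k)
    case (Suc k)
    define s where "s = t - real (Suc k) * h"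
    have s: "0 < s" using Suc.prems unfolding s_def by simp
    have inc: "f (s + real j * h + h) - f (s + real j * h) \<le> f (s + h) - f s" for j
      using step[OF s \<open>0 < h\<close>]
    proof (induction j)
      case (Suc j)
      have "h < s + real j * h + h" using s that by (simp add: add_pos_nonneg)
      then show ?case
        using Suc mid[of h "s + real j * h + h"] that by (simp add: algebra_simps)
    qed simp
    have "f (t + h) - f t \<le> f (s + h) - f s"
      using inc[of "Suc k"] unfolding s_def by (simp add: algebra_simps)
    moreover have e: "t - real k * h = s + h" unfolding s_def by (simp add: algebra_simps)
    moreover have "real k * (f (t + h) - f t) \<le> f t - f (s + h)"
      using Suc.IH s \<open>0 < h\<close> unfolding e by simp
    ultimately show ?case unfolding s_def[symmetric] by (simp add: algebra_simps)
  qed simp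
  define D where "D = f y - f z"
  have D: "0 \<le> D" using mono[of z y] xyz unfolding D_def by simp
  define q where "q = (z - x) / (y - z)"
  have q: "0 < q" using xyz unfolding q_def by simp
  \<comment> \<open>The increment from \<open>z\<close> to \<open>z + h\<close> mediates: it is at
    least the average of the \<open>N\<close> increments up to \<open>y\<close> and at most each of
    the \<open>M\<close> increments below \<open>z\<close>. Rounding \<open>M\<close> down loses
    less than one step, that is, less than \<open>1 / real N\<close> in the ratio
    \<open>q\<close>.\<close>
  have main: "(q - 1 / real N) * D \<le> f z - f x" if N: "0 < N" for N :: nat
  proof -
    define h where "h = (y - z) / real N"
    have h: "0 < h" "real N * h = y - z" using xyz N unfolding h_def by auto
    define M where "M = nat \<lfloor>(z - x) / h\<rfloor>"
    have "0 \<le> (z - x) / h" using h xyz by simp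
    then have "real M = of_int \<lfloor>(z - x) / h\<rfloor>"
      unfolding M_def by simp
    then have M: "real M \<le> (z - x) / h" "(z - x) / h - 1 < real M"
      by linarith+
    have Mh: "real M * h \<le> z - x" using M h by (simp add: field_simps)
    have "D \<le> real N * (f (z + h) - f z)"
      using step[of z h N] h xyz unfolding D_def by simp
    then have *: "D / real N \<le> f (z + h) - f z"
      using N by (simp add: field_simps)
    have "q - 1 / real N = ((z - x) / h - 1) / real N"
      using N xyz unfolding q_def h_def by (simp add: field_simps)
    also have "\<dots> \<le> real M / real N" using M by (intro divide_right_mono) auto
    finally have "(q - 1 / real N) * D \<le> real M / real N * D"
      using D by (rule mult_right_mono)
    also have "\<dots> = real M * (D / real N)" by simp
    also have "\<dots> \<le> real M * (f (z + h) - f z)"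
      using * by (intro mult_left_mono) auto
    also have "\<dots> \<le> f z - f (z - real M * h)"
      using step'[of z M h] h Mh xyz by simp
    also have "\<dots> \<le> f z - f x"
      using mono[of x "z - real M * h"] Mh xyz by simp
    finally show ?thesis .
  qed
  have "(\<lambda>N. (q - 1 / real N) * D) \<longlonglongrightarrow> (q - 0) * D"
    by (intro tendsto_intros lim_1_over_n)
  then have "(q - 0) * D \<le> f z - f x"
    by (rule LIMSEQ_le_const2) (use main in \<open>auto intro!: exI[of _ 1]\<close>)
  then show ?thesis
    using xyz unfolding q_def D_def by (simp add: field_simps)
qed

text \<open>The slope is the supremum of the secant slopes to the right of \<open>z\<close>; every
  secant slope to the left bounds them from above. Monotonicity makes it nonnegative.\<close>

lemma midpoint_concave_supporting_line:
  fixes f :: "real \<Rightarrow> real"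
  assumes mono: "\<And>x y. 0 < x \<Longrightarrow> x \<le> y \<Longrightarrow> f x \<le> f y"
    and mid: "\<And>x h. 0 < h \<Longrightarrow> h < x \<Longrightarrow> f (x + h) + f (x - h) \<le> 2 * f x"
    and z: "0 < z"
  shows "\<exists>c\<ge>0. \<forall>x>0. f x \<le> f z + c * (x - z)"
proof -
  let ?S = "(\<lambda>y. (f y - f z) / (y - z)) ` {z<..}"
  define c where "c = Sup ?S"
  note slope = midpoint_concave_slope_le[of f, OF mono mid]
  have bdd: "bdd_above ?S"
    by (rule bdd_aboveI2[of _ _ "(f z - f (z / 2)) / (z - z / 2)"]) (rule slope, use z in auto)
  have up: "f x \<le> f z + c * (x - z)" if "z < x" for x
  proof -
    have "(f x - f z) / (x - z) \<le> c"
      unfolding c_def using that by (intro cSup_upper bdd) auto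
    then show ?thesis using that by (simp add: field_simps)
  qed
  have lo: "f x \<le> f z + c * (x - z)" if "0 < x" "x < z" for x
  proof -
    have "c \<le> (f z - f x) / (z - x)"
      unfolding c_def using that by (intro cSup_least) (auto intro!: slope)
    then show ?thesis using that by (simp add: field_simps)
  qed
  have "0 \<le> c"
    using up[of "z + 1"] mono[of z "z + 1"] z by simp
  moreover have "f x \<le> f z + c * (x - z)" if "0 < x" for x
    using up[of x] lo[of x] that by (cases x z rule: linorder_cases) auto
  ultimately show ?thesis by blast
qed

section \<open>Linear change of variables and Gaussian integrals\<close>

lemma det_shear:
  fixes m n :: "'n::finite"
  assumes "m \<noteq> n"
  shows "det (matrix (\<lambda>x::real^'n. \<chi> i. if i = m then x$m + x$n else x$i)) = 1"
proof -
  have "matrix (\<lambda>x::real^'n. \<chi> i. if i = m then x$m + x$n else x$i) =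
      (\<chi> k. if k = m then row m (mat 1) + 1 *s row n (mat 1) else row k (mat 1))"
    by (auto simp: matrix_def vec_eq_iff row_def mat_def axis_def)
  then show ?thesis
    using det_row_operation[OF assms, of "mat 1" 1] by simp
qed

text \<open>The volume is first preserved on closed boxes; the general criterion for linear maps
  transfers this to the preimage of an open box, which is bounded because the inverse shear is
  linear.\<close>

lemma emeasure_shear_box:
  fixes m n :: "'n::finite" and a b :: "real^'n"
  assumes mn: "m \<noteq> n"
  defines "h \<equiv> \<lambda>x::real^'n. \<chi> i. if i = m then x$m + x$n else x$i"
  shows "emeasure lborel (h -` box a b) = emeasure lborel (box a b)"
proof -
  have lin: "linear h"
    unfolding h_def by (rule linearI) (auto simp: algebra_simps plus_vec_def scaleR_vec_def vec_eq_iff)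
  have cb: "measure lebesgue (h ` cbox a b) = 1 * measure lebesgue (cbox a b)" for a b
  proof (cases "cbox a b = {}")
    case False
    \<comment> \<open>This translation makes the lower corner vanish in coordinate \<open>n\<close>,
      as \<open>measure_shear_interval\<close> requires a nonnegative corner there;
      \<open>?w\<close> undoes its effect after the shear.\<close>
    let ?v = "\<chi> i. if i = n then - a $ n else 0"
    let ?w = "\<chi> i. if i = m \<or> i = n then a $ n else 0"
    have ne: "cbox (?v + a) (?v + b) \<noteq> {}"
      using False by (simp add: cbox_translation)
    have "?w + h (?v + x) = h x" for x
      using mn unfolding h_def by (auto simp: vec_eq_iff)
    then have "h ` cbox a b = (+) ?w ` h ` (+) ?v ` cbox a b"
      unfolding image_image by simp
    then have "measure lebesgue (h ` cbox a b) = measure lebesgue (h ` cbox (?v + a) (?v + b))"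
      by (simp only: cbox_translation measure_translation)
    also have "\<dots> = measure lebesgue (cbox (?v + a) (?v + b))"
      unfolding h_def by (rule measure_shear_interval[OF mn ne]) simp
    also have "\<dots> = measure lebesgue (cbox a b)"
      by (simp only: cbox_translation measure_translation)
    finally show ?thesis by simp
  qed simp
  define g where "g = (\<lambda>x::real^'n. \<chi> i. if i = m then x$m - x$n else x$i)"
  have "linear g"
    unfolding g_def by (rule linearI) (auto simp: algebra_simps plus_vec_def scaleR_vec_def vec_eq_iff)
  have gh: "g (h x) = x" "h (g x) = x" for x
    using mn unfolding g_def h_def by (auto simp: vec_eq_iff)
  have pre: "h -` box a b = g ` box a b" and img: "h ` (h -` box a b) = box a b"
    using gh by (auto simp: image_iff; metis)+
  have "bounded (h -` box a b)"
    unfolding pre using \<open>linear g\<close> by (intro bounded_linear_image linear_conv_bounded_linear[THEN iffD1]) auto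
  moreover have op: "open (h -` box a b)"
    using lin by (intro continuous_open_vimage) (auto intro: linear_continuous_at simp: linear_conv_bounded_linear)
  ultimately have lm: "h -` box a b \<in> lmeasurable"
    by (intro lmeasurable_open)
  have "measure lebesgue (h -` box a b) = measure lebesgue (box a b)"
    using measure_linear_sufficient[OF lin lm, of 1] cb img by simp
  then have "measure lborel (h -` box a b) = measure lborel (box a b)"
    using op by simp
  moreover have "emeasure lborel (h -` box a b) \<noteq> \<infinity>"
    using emeasure_bounded_finite[OF \<open>bounded (h -` box a b)\<close>] by auto
  moreover have "emeasure lborel (box a b) \<noteq> \<infinity>"
    using emeasure_lborel_box_finite[of a b] by auto
  ultimately show ?thesis
    by (simp add: emeasure_eq_ennreal_measure)
qed

lemma linear_borel_measurable: "linear (f :: 'a::euclidean_space \<Rightarrow> 'b::euclidean_space) \<Longrightarrow> f \<in> borel_measurable borel"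
  by (intro borel_measurable_continuous_onI linear_continuous_on) (simp add: linear_conv_bounded_linear)

text \<open>The formula is multiplicative under composition, so elementary maps suffice. A vanishing
  coordinate contradicts the nonzero determinant, diagonal maps are affine scalings, and
  transpositions and shears preserve Lebesgue measure because they preserve the volumes of
  boxes.\<close>

lemma nn_integral_linear_image:
  fixes f :: "real^'n::finite \<Rightarrow> real^'n"
  assumes "linear f" "det (matrix f) \<noteq> 0" "G \<in> borel_measurable borel"
  shows "(\<integral>\<^sup>+x. G x \<partial>lborel) = ennreal \<bar>det (matrix f)\<bar> * (\<integral>\<^sup>+x. G (f x) \<partial>lborel)"
proof -
  have distr: "(\<integral>\<^sup>+x. G x \<partial>lborel) = ennreal \<bar>det (matrix h)\<bar> * (\<integral>\<^sup>+x. G (h x) \<partial>lborel)"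
    if "linear h" "\<bar>det (matrix h)\<bar> = 1" "distr lborel borel h = lborel" "G \<in> borel_measurable borel"
    for h :: "real^'n \<Rightarrow> real^'n" and G :: "real^'n \<Rightarrow> ennreal"
  proof -
    have "(\<integral>\<^sup>+x. G x \<partial>lborel) = (\<integral>\<^sup>+x. G x \<partial>distr lborel borel h)"
      using that(3) by simp
    also have "\<dots> = (\<integral>\<^sup>+x. G (h x) \<partial>lborel)"
      using that linear_borel_measurable by (intro nn_integral_distr) auto
    finally show ?thesis using that(2) by simp
  qed
  have "det (matrix f) \<noteq> 0 \<longrightarrow> (\<forall>G\<in>borel_measurable borel.
     (\<integral>\<^sup>+x. G x \<partial>lborel) = ennreal \<bar>det (matrix f)\<bar> * (\<integral>\<^sup>+x. G (f x) \<partial>lborel))"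
  proof (rule induct_linear_elementary[OF assms(1)]; intro impI ballI)
    fix f g :: "real^'n \<Rightarrow> real^'n" and G :: "real^'n \<Rightarrow> ennreal"
    assume lin: "linear f" "linear g"
      and f: "det (matrix f) \<noteq> 0 \<longrightarrow> (\<forall>G\<in>borel_measurable borel.
        (\<integral>\<^sup>+x. G x \<partial>lborel) = ennreal \<bar>det (matrix f)\<bar> * (\<integral>\<^sup>+x. G (f x) \<partial>lborel))"
      and g: "det (matrix g) \<noteq> 0 \<longrightarrow> (\<forall>G\<in>borel_measurable borel.
        (\<integral>\<^sup>+x. G x \<partial>lborel) = ennreal \<bar>det (matrix g)\<bar> * (\<integral>\<^sup>+x. G (g x) \<partial>lborel))"
      and fg: "det (matrix (f \<circ> g)) \<noteq> 0" and G: "G \<in> borel_measurable borel"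
    have det: "det (matrix (f \<circ> g)) = det (matrix f) * det (matrix g)"
      using lin by (simp add: matrix_compose det_mul)
    then have nz: "det (matrix f) \<noteq> 0" "det (matrix g) \<noteq> 0" using fg by auto
    have Gf: "(\<lambda>x. G (f x)) \<in> borel_measurable borel"
      using linear_borel_measurable[OF lin(1)] G by measurable
    have "(\<integral>\<^sup>+x. G x \<partial>lborel) = ennreal \<bar>det (matrix f)\<bar> * (\<integral>\<^sup>+x. G (f x) \<partial>lborel)"
      using f nz G by blast
    also have "(\<integral>\<^sup>+x. G (f x) \<partial>lborel) = ennreal \<bar>det (matrix g)\<bar> * (\<integral>\<^sup>+x. G (f (g x)) \<partial>lborel)"
      using g nz Gf by blast
    finally show "(\<integral>\<^sup>+x. G x \<partial>lborel) =
        ennreal \<bar>det (matrix (f \<circ> g))\<bar> * (\<integral>\<^sup>+x. G ((f \<circ> g) x) \<partial>lborel)"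
      unfolding det by (simp add: abs_mult ennreal_mult mult.assoc)
  next
    fix f :: "real^'n \<Rightarrow> real^'n" and i and G :: "real^'n \<Rightarrow> ennreal"
    assume "linear f" "\<And>x. f x $ i = 0" and nz: "det (matrix f) \<noteq> 0"
    then have "row i (matrix f) = 0"
      by (simp add: matrix_def row_def vec_eq_iff)
    then show "(\<integral>\<^sup>+x. G x \<partial>lborel) = ennreal \<bar>det (matrix f)\<bar> * (\<integral>\<^sup>+x. G (f x) \<partial>lborel)"
      using nz det_zero_row(2) by blast
  next
    fix c and G :: "real^'n \<Rightarrow> ennreal"
    assume nz: "det (matrix (\<lambda>x::real^'n. \<chi> i. c i * x $ i)) \<noteq> 0" and G: "G \<in> borel_measurable borel"
    have det: "det (matrix (\<lambda>x::real^'n. \<chi> i. c i * x $ i)) = (\<Prod>i\<in>UNIV. c i)"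
      by (subst det_diagonal) (auto simp: matrix_def axis_def)
    then have c: "c i \<noteq> 0" for i using nz by simp
    \<comment> \<open>The diagonal map again, written as a sum over the basis to match
      \<open>lborel_affine_euclidean\<close>.\<close>
    define T :: "real^'n \<Rightarrow> real^'n" where "T = (\<lambda>x. 0 + (\<Sum>j\<in>Basis. (c (axis_index j) * (x \<bullet> j)) *\<^sub>R j))"
    have T: "T x = (\<chi> i. c i * x $ i)" for x
    proof (rule vec_eq_iff[THEN iffD2], rule allI)
      fix i :: 'n
      have "axis i (1::real) \<in> Basis" by (auto simp: Basis_vec_def)
      then have "T x \<bullet> axis i 1 = c (axis_index (axis i (1::real))) * (x \<bullet> axis i 1)"
        unfolding T_def by simp
      then show "T x $ i = (\<chi> i. c i * x $ i) $ i"
        by (simp add: inner_axis axis_index_axis)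
    qed
    have "lborel = density (distr lborel borel T) (\<lambda>_. (\<Prod>j\<in>(Basis :: (real^'n) set). \<bar>c (axis_index j)\<bar>))"
      unfolding T_def by (rule lborel_affine_euclidean) (simp add: c)
    moreover have "(\<Prod>j\<in>(Basis :: (real^'n) set). \<bar>c (axis_index j)\<bar>) = \<bar>\<Prod>i\<in>UNIV. c i\<bar>"
      unfolding abs_prod
      by (intro prod.reindex_bij_betw bij_betwI[where g = "\<lambda>i. axis i 1"])
        (auto simp: Basis_vec_def axis_index_axis)
    ultimately have lb: "lborel = density (distr lborel borel T) (\<lambda>_. ennreal \<bar>\<Prod>i\<in>UNIV. c i\<bar>)"
      by simp
    have Tm: "T \<in> borel_measurable borel" unfolding T_def by measurable
    have "(\<integral>\<^sup>+x. G x \<partial>lborel) = ennreal \<bar>\<Prod>i\<in>UNIV. c i\<bar> * (\<integral>\<^sup>+x. G (T x) \<partial>lborel)"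
      by (subst lb) (use Tm G in \<open>simp add: nn_integral_density nn_integral_distr nn_integral_cmult\<close>)
    then show "(\<integral>\<^sup>+x. G x \<partial>lborel) = ennreal \<bar>det (matrix (\<lambda>x::real^'n. \<chi> i. c i * x $ i))\<bar> *
        (\<integral>\<^sup>+x. G (\<chi> i. c i * x $ i) \<partial>lborel)"
      unfolding det T .
  next
    fix m n :: 'n and G :: "real^'n \<Rightarrow> ennreal"
    assume mn: "m \<noteq> n" and G: "G \<in> borel_measurable borel"
    let ?t = "Transposition.transpose m n"
    let ?h = "\<lambda>x::real^'n. \<chi> i. x $ ?t i"
    have lin: "linear ?h"
      by (rule linearI) (simp_all add: plus_vec_def scaleR_vec_def)
    have "matrix ?h = (\<chi> i. mat 1 $ ?t i)"
      by (auto simp: matrix_def vec_eq_iff mat_def axis_def)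
    then have "\<bar>det (matrix ?h)\<bar> = 1"
      by (simp add: det_permute_rows permutes_swap_id abs_mult sign_def)
    moreover have "lborel = distr lborel borel ?h"
    proof (rule lborel_eqI)
      fix l u :: "real^'n" assume le: "\<And>b. b \<in> Basis \<Longrightarrow> l \<bullet> b \<le> u \<bullet> b"
      have vim: "?h -` box l u = box (?h l) (?h u)"
        by (auto simp: mem_box_cart) (metis transpose_involutory)+
      have "emeasure (distr lborel borel ?h) (box l u) = emeasure lborel (box (?h l) (?h u))"
        using linear_borel_measurable[OF lin] by (simp add: emeasure_distr vim)
      also have "\<dots> = ennreal (\<Prod>i\<in>UNIV. (u - l) $ ?t i)"
      proof -
        have "l $ i \<le> u $ i" for i
          using le[of "axis i 1"] by (auto simp: Basis_vec_def inner_axis)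
        then show ?thesis
          by (subst emeasure_lborel_box) (auto simp: Basis_vec_def inner_axis prod.UNION_disjoint axis_eq_axis)
      qed
      also have "(\<Prod>i\<in>UNIV. (u - l) $ ?t i) = (\<Prod>i\<in>UNIV. (u - l) $ i)"
        by (rule prod.permute[OF permutes_swap_id, symmetric, unfolded o_def]) auto
      also have "\<dots> = (\<Prod>b\<in>Basis. (u - l) \<bullet> b)"
        by (auto simp: Basis_vec_def inner_axis prod.UNION_disjoint axis_eq_axis)
      finally show "emeasure (distr lborel borel ?h) (box l u) = (\<Prod>b\<in>Basis. (u - l) \<bullet> b)" .
    qed simp
    ultimately show "(\<integral>\<^sup>+x. G x \<partial>lborel) = ennreal \<bar>det (matrix ?h)\<bar> * (\<integral>\<^sup>+x. G (?h x) \<partial>lborel)"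
      using lin G by (intro distr) auto
  next
    fix m n :: 'n and G :: "real^'n \<Rightarrow> ennreal"
    assume mn: "m \<noteq> n" and G: "G \<in> borel_measurable borel"
    let ?h = "\<lambda>x::real^'n. \<chi> i. if i = m then x$m + x$n else x$i"
    have lin: "linear ?h"
      by (rule linearI) (auto simp: algebra_simps plus_vec_def scaleR_vec_def vec_eq_iff)
    have "lborel = distr lborel borel ?h"
    proof (rule lborel_eqI)
      fix l u :: "real^'n" assume le: "\<And>b. b \<in> Basis \<Longrightarrow> l \<bullet> b \<le> u \<bullet> b"
      show "emeasure (distr lborel borel ?h) (box l u) = (\<Prod>b\<in>Basis. (u - l) \<bullet> b)"
        using linear_borel_measurable[OF lin] emeasure_shear_box[OF mn, of l u] le
        by (simp add: emeasure_distr)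
    qed simp
    then show "(\<integral>\<^sup>+x. G x \<partial>lborel) = ennreal \<bar>det (matrix ?h)\<bar> * (\<integral>\<^sup>+x. G (?h x) \<partial>lborel)"
      using lin G det_shear[OF mn] by (intro distr) auto
  qed
  then show ?thesis using assms by blast
qed

section \<open>Gaussian integrals\<close>

text \<open>Substituting \<open>sqrt pi * s\<close> in the integral of
  \<open>exp (- x\<^sup>2)\<close> over the half-line, which is \<open>sqrt pi / 2\<close>. The
  factor \<open>pi\<close> in the exponent normalizes the total mass to 1.\<close>

lemma nn_integral_gaussian_half_line:
  "(\<integral>\<^sup>+s. ennreal (exp (- pi * s\<^sup>2)) * indicator {0..} s \<partial>lborel) = ennreal (1 / 2)"
proof -
  have "(\<integral>\<^sup>+x. ennreal (indicator {0..} x *\<^sub>R exp (- x\<^sup>2)) \<partial>lborel) = ennreal (sqrt pi / 2)"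
    using nn_integral_eq_integral[of lborel "\<lambda>x. indicator {0..} x *\<^sub>R exp (- x\<^sup>2)"] gaussian_moment_0
    by (simp add: has_bochner_integral_iff)
  moreover have "(\<lambda>x::real. ennreal (indicator {0..} x *\<^sub>R exp (- x\<^sup>2))) = (\<lambda>x. ennreal (exp (- x\<^sup>2)) * indicator {0..} x)"
    by (auto simp: indicator_def)
  ultimately have "ennreal (sqrt pi / 2) = (\<integral>\<^sup>+x. ennreal (exp (- x\<^sup>2)) * indicator {0..} x \<partial>lborel)"
    by metis
  also have "\<dots> = \<bar>sqrt pi\<bar> * (\<integral>\<^sup>+x. ennreal (exp (- (0 + sqrt pi * x)\<^sup>2)) * indicator {0..} (0 + sqrt pi * x) \<partial>lborel)"
    by (rule nn_integral_real_affine) auto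
  also have "(\<integral>\<^sup>+x. ennreal (exp (- (0 + sqrt pi * x)\<^sup>2)) * indicator {0..} (0 + sqrt pi * x) \<partial>lborel)
      = (\<integral>\<^sup>+s. ennreal (exp (- pi * s\<^sup>2)) * indicator {0..} s \<partial>lborel)"
    using pi_gt_zero by (auto intro!: nn_integral_cong simp: indicator_def power_mult_distrib zero_le_mult_iff not_le)
  finally have "ennreal (sqrt pi / 2) = ennreal (sqrt pi) *
      (\<integral>\<^sup>+s. ennreal (exp (- pi * s\<^sup>2)) * indicator {0..} s \<partial>lborel)" by (simp only: abs_of_nonneg[OF real_sqrt_ge_zero[OF pi_ge_zero]])
  moreover have "ennreal (sqrt pi / 2) = ennreal (sqrt pi) * ennreal (1 / 2)"
    by (subst ennreal_mult[symmetric]) auto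
  ultimately have "ennreal (sqrt pi) * (\<integral>\<^sup>+s. ennreal (exp (- pi * s\<^sup>2)) * indicator {0..} s \<partial>lborel)
     = ennreal (sqrt pi) * ennreal (1 / 2)"
    by (simp only:)
  then show ?thesis
    by (subst (asm) ennreal_mult_cancel_left) auto
qed

lemma nn_integral_gaussian:
  "(\<integral>\<^sup>+s. ennreal (exp (- pi * s\<^sup>2)) \<partial>lborel) = 1"
proof -
  let ?g = "\<lambda>s::real. ennreal (exp (- pi * s\<^sup>2))"
  have "(\<integral>\<^sup>+s. ?g s \<partial>lborel) = (\<integral>\<^sup>+s. ?g s * indicator {0..} s + ?g s * indicator {..0} s \<partial>lborel)"
  proof (rule nn_integral_cong_AE)
    show "AE s in lborel. ?g s = ?g s * indicator {0..} s + ?g s * indicator {..0} s"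
      using AE_lborel_singleton[of 0] by eventually_elim (auto simp: indicator_def)
  qed
  also have "\<dots> = (\<integral>\<^sup>+s. ?g s * indicator {0..} s \<partial>lborel) + (\<integral>\<^sup>+s. ?g s * indicator {..0} s \<partial>lborel)"
    by (rule nn_integral_add) auto
  also have "(\<integral>\<^sup>+s. ?g s * indicator {..0} s \<partial>lborel) = (\<integral>\<^sup>+s. ?g s * indicator {0..} s \<partial>lborel)"
    by (subst nn_integral_real_affine[of _ "-1" 0]) (auto simp: indicator_def intro!: nn_integral_cong)
  also note nn_integral_gaussian_half_line
  also have "ennreal (1 / 2) + ennreal (1 / 2) = 1"
    by (subst ennreal_plus[symmetric]) auto
  finally show ?thesis .
qed

lemma nn_integral_gaussian_norm:
  "(\<integral>\<^sup>+x. ennreal (exp (- pi * (norm (x::'a::euclidean_space))\<^sup>2)) \<partial>lborel) = 1"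
proof -
  have "(norm x)\<^sup>2 = (\<Sum>b\<in>Basis. (x \<bullet> b)\<^sup>2)" for x :: 'a
    unfolding power2_norm_eq_inner by (subst euclidean_inner) (simp add: power2_eq_square)
  then have "ennreal (exp (- pi * (norm x)\<^sup>2)) = (\<Prod>b\<in>Basis. ennreal (exp (- pi * (x \<bullet> b)\<^sup>2)))" for x :: 'a
    by (simp add: prod_ennreal sum_distrib_left sum_negf flip: exp_sum)
  then have "(\<integral>\<^sup>+(x::'a). ennreal (exp (- pi * (norm x)\<^sup>2)) \<partial>lborel)
     = (\<Prod>b\<in>(Basis::'a set). (\<integral>\<^sup>+s. ennreal (exp (- pi * s\<^sup>2)) \<partial>lborel))"
    using nn_integral_lborel_prod[of "\<lambda>b::'a. \<lambda>s. ennreal (exp (- pi * s\<^sup>2))"] by simp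
  then show ?thesis by (simp only: nn_integral_gaussian prod.neutral_const)
qed

text \<open>The range of \<open>N\<close> has dimension \<open>CARD('n)\<close> and is isometric to
  the whole space, so \<open>N\<close> may be replaced by a square matrix \<open>Q\<close> with the
  same norms. By polarization the Gram matrices agree, and the square case is a linear change of
  variables.\<close>

lemma nn_integral_gaussian_matrix:
  fixes N :: "real^'n^'r"
  assumes injN: "inj ((*v) N)"
  shows "0 < det (transpose N ** N)"
    and "(\<integral>\<^sup>+t. ennreal (exp (- pi * (norm (N *v t))\<^sup>2)) \<partial>lborel)
       = ennreal (1 / sqrt (det (transpose N ** N)))"
proof -
  have "dim (range ((*v) N)) = CARD('n)"
    using injN by (simp add: dim_image_eq)
  then have "dim (range ((*v) N)) = dim (UNIV :: (real^'n) set)" by simp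
  then obtain f :: "real^'r \<Rightarrow> real^'n" where f: "linear f" "f ` range ((*v) N) = UNIV"
      "\<And>x. x \<in> range ((*v) N) \<Longrightarrow> norm (f x) = norm x"
    using isometry_subspaces[of "range ((*v) N)" "UNIV :: (real^'n) set"]
    by (metis matrix_vector_mul_linear linear_subspace_image subspace_UNIV)
  define g where "g = (\<lambda>t. f (N *v t))"
  have lin: "linear g"
    unfolding g_def using linear_compose[OF matrix_vector_mul_linear[of N] f(1)] by (simp add: o_def)
  have ng: "norm (g t) = norm (N *v t)" for t
    unfolding g_def using f(3) by simp
  define Q where "Q = matrix g"
  have Q: "Q *v t = g t" for t unfolding Q_def using lin by (simp add: matrix_works)
  have polar: "x \<bullet> y = ((norm (x + y))\<^sup>2 - (norm x)\<^sup>2 - (norm y)\<^sup>2) / 2" for x y :: "'b::real_inner"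
    by (simp add: power2_norm_eq_inner inner_add_left inner_add_right inner_commute)
  have nQ: "norm (Q *v t) = norm (N *v t)" for t by (simp add: Q ng)
  have "(Q *v x) \<bullet> (Q *v y) = (N *v x) \<bullet> (N *v y)" for x y
    unfolding polar[of "Q *v x"] polar[of "N *v x"] matrix_vector_right_distrib[symmetric] nQ ..
  moreover have "x \<bullet> (transpose Q *v z) = (Q *v x) \<bullet> z" for x z
    using dot_lmul_matrix[of x "transpose Q" z] by simp
  moreover have "x \<bullet> (transpose N *v z) = (N *v x) \<bullet> z" for x z
    using dot_lmul_matrix[of x "transpose N" z] by simp
  ultimately have "x \<bullet> ((transpose Q ** Q) *v y) = x \<bullet> ((transpose N ** N) *v y)" for x y
    unfolding matrix_vector_mul_assoc[symmetric] by simp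
  then have "(transpose Q ** Q) *v y = (transpose N ** N) *v y" for y
    using vector_eq_ldot by blast
  then have "transpose Q ** Q = transpose N ** N"
    unfolding matrix_eq by blast
  then have detN: "det (transpose N ** N) = (det Q)\<^sup>2"
    by (metis det_mul det_transpose power2_eq_square)
  have "inj g"
    using lin ng injN by (metis linear_injective_0 matrix_vector_mul_linear norm_eq_zero)
  then have nz: "det Q \<noteq> 0"
    unfolding Q_def using det_nz_iff_inj[OF lin] by blast
  then show "0 < det (transpose N ** N)" unfolding detN by simp
  have "ennreal \<bar>det Q\<bar> * (\<integral>\<^sup>+t. ennreal (exp (- pi * (norm (g t))\<^sup>2)) \<partial>lborel) = 1"
    using nn_integral_linear_image[OF lin, of "\<lambda>x. ennreal (exp (- pi * (norm x)\<^sup>2))"] nz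
    unfolding Q_def[symmetric] nn_integral_gaussian_norm by simp
  moreover have "ennreal \<bar>det Q\<bar> * ennreal (1 / \<bar>det Q\<bar>) = 1"
    using nz by (subst ennreal_mult[symmetric]) auto
  ultimately have "ennreal \<bar>det Q\<bar> * ennreal (1 / \<bar>det Q\<bar>)
      = ennreal \<bar>det Q\<bar> * (\<integral>\<^sup>+t. ennreal (exp (- pi * (norm (g t))\<^sup>2)) \<partial>lborel)"
    by (simp only:)
  then have "ennreal (1 / \<bar>det Q\<bar>) = (\<integral>\<^sup>+t. ennreal (exp (- pi * (norm (g t))\<^sup>2)) \<partial>lborel)"
    by (subst (asm) ennreal_mult_cancel_left) (use nz in auto)
  then show "(\<integral>\<^sup>+t. ennreal (exp (- pi * (norm (N *v t))\<^sup>2)) \<partial>lborel)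
       = ennreal (1 / sqrt (det (transpose N ** N)))"
    unfolding detN ng by simp
qed

section \<open>Integer points in small slab intersections\<close>

text \<open>Each form has its own half-width, because the comparison with Gaussians varies one
  half-width while the others stay fixed.\<close>

definition slab_body :: "real^'n^'r \<Rightarrow> ('r \<Rightarrow> real) \<Rightarrow> (real^'n) set" where
  "slab_body N \<rho> = {t. \<forall>j. \<bar>(N *v t) $ j\<bar> < \<rho> j}"

lemma open_slab_body: "open (slab_body (N :: real^'n^'r) \<rho>)"
proof -
  have "continuous_on UNIV (\<lambda>t. (N *v t) $ j)" for j
    by (intro continuous_intros linear_continuous_on_compose[of _ id, simplified] matrix_vector_mul_linear)
  then have "open {t. \<bar>(N *v t) $ j\<bar> < \<rho> j}" for j
    by (intro open_Collect_less continuous_intros)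
  then show ?thesis
    unfolding slab_body_def Collect_all_eq by (intro open_INT) auto
qed

lemma bounded_slab_body:
  fixes N :: "real^'n^'r"
  assumes inj: "inj ((*v) N)"
  shows "bounded (slab_body N \<rho>)"
proof -
  obtain B where B: "B > 0" "\<And>t. B * norm t \<le> norm (N *v t)"
    using linear_inj_bounded_below_pos[of "(*v) N"] inj by auto
  have "norm t \<le> (\<Sum>j\<in>UNIV. \<bar>\<rho> j\<bar>) / B" if "t \<in> slab_body N \<rho>" for t
  proof -
    have "B * norm t \<le> (\<Sum>j\<in>UNIV. \<bar>(N *v t) $ j\<bar>)"
      using B(2)[of t] norm_le_l1_cart[of "N *v t"] by linarith
    also have "\<dots> \<le> (\<Sum>j\<in>UNIV. \<bar>\<rho> j\<bar>)"
    proof (rule sum_mono)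
      fix j
      have "\<bar>(N *v t) $ j\<bar> < \<rho> j" using that unfolding slab_body_def by simp
      then show "\<bar>(N *v t) $ j\<bar> \<le> \<bar>\<rho> j\<bar>" by linarith
    qed
    finally show ?thesis using B(1) by (simp add: field_simps)
  qed
  then show ?thesis unfolding bounded_iff by blast
qed

lemma slab_body_supporting_line:
  fixes N :: "real^'n^'r"
  assumes inj: "inj ((*v) N)" and z: "0 < z"
  shows "\<exists>c\<ge>0. \<forall>x>0. measure lborel (slab_body N (\<rho>(i := x)))
    \<le> measure lborel (slab_body N (\<rho>(i := z))) + c * (x - z)"
proof (cases "row i N = 0")
  \<comment> \<open>A zero row imposes no condition when the half-width is positive, so the volume
    is constant and slope 0 works.\<close>
  case True
  then have "(N *v t) $ i = 0" for t
    by (simp add: matrix_vector_mul_component row_def)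
  then have "slab_body N (\<rho>(i := x)) = slab_body N (\<rho>(i := z))" if "0 < x" for x
    using that z unfolding slab_body_def by (auto; metis abs_zero fun_upd_other fun_upd_same)
  then show ?thesis by (intro exI[of _ 0]) auto
next
  case False
  let ?C = "{t. \<forall>j. j \<noteq> i \<longrightarrow> \<bar>(N *v t) $ j\<bar> < \<rho> j}"
  have comp: "(N *v t) $ j = row j N \<bullet> t" for j t
    by (simp add: matrix_vector_mul_component row_def)
  have eq: "slab_body N (\<rho>(i := x)) = ?C \<inter> {t. \<bar>row i N \<bullet> t\<bar> < x}" for x
    unfolding slab_body_def by (auto simp: comp split: if_splits)
  have "open {t. j \<noteq> i \<longrightarrow> \<bar>(N *v t) $ j\<bar> < \<rho> j}" for j
    unfolding comp by (cases "j = i") (auto intro!: open_Collect_less continuous_intros)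
  then have opC: "open ?C" unfolding Collect_all_eq by (intro open_INT) auto
  have "convex {t. \<bar>row j N \<bullet> t\<bar> < s}" for j s
  proof -
    have "{t. \<bar>row j N \<bullet> t\<bar> < s} = {t. row j N \<bullet> t < s} \<inter> {t. row j N \<bullet> t > - s}" by auto
    then show ?thesis by (simp add: convex_Int convex_halfspace_lt convex_halfspace_gt)
  qed
  then have "convex (\<Inter>j\<in>-{i}. {t. \<bar>row j N \<bullet> t\<bar> < \<rho> j})"
    by (intro convex_INT)
  moreover have "?C = (\<Inter>j\<in>-{i}. {t. \<bar>row j N \<bullet> t\<bar> < \<rho> j})"
    unfolding comp by auto
  ultimately have cvC: "convex ?C" by (simp only:)
  have symC: "uminus ` ?C = ?C"
    unfolding uminus_image_eq_vimage by (auto simp: comp)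
  have bdd: "bounded (?C \<inter> {t. \<bar>row i N \<bullet> t\<bar> < x})" for x
    using bounded_slab_body[OF inj] unfolding eq[symmetric] .
  have fm: "?C \<inter> {t. \<bar>row i N \<bullet> t\<bar> < x} \<in> fmeasurable lborel" for x
    using bdd open_slab_body[of N "\<rho>(i := x)"] unfolding eq by (intro bounded_open_fmeasurable)
  show ?thesis
    unfolding eq
  proof (rule midpoint_concave_supporting_line)
    show "measure lborel (?C \<inter> {t. \<bar>row i N \<bullet> t\<bar> < x}) \<le> measure lborel (?C \<inter> {t. \<bar>row i N \<bullet> t\<bar> < y})"
      if "x \<le> y" for x y
      using that fm fmeasurableD[OF fm[of x]] by (intro measure_mono_fmeasurable) auto
  qed (use measure_slab_midpoint_concave[OF opC cvC symC bdd False] z in auto)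
qed

section \<open>Gaussian factors as mixtures of slabs\<close>

text \<open>Half the length of the interval on which \<open>exp (- pi * s\<^sup>2)\<close> exceeds
  the level \<open>l\<close>, for \<open>l\<close> between 0 and 1.\<close>

definition gauss_radius :: "real \<Rightarrow> real" where
  "gauss_radius l = sqrt (- ln l / pi)"

lemma less_gauss_radius_iff:
  assumes "0 < l" "l < 1"
  shows "\<bar>s\<bar> < gauss_radius l \<longleftrightarrow> l < exp (- pi * s\<^sup>2)"
proof -
  have "\<bar>s\<bar> < gauss_radius l \<longleftrightarrow> s\<^sup>2 < - ln l / pi"
    unfolding gauss_radius_def by (metis real_sqrt_abs real_sqrt_less_iff)
  also have "\<dots> \<longleftrightarrow> ln l < - pi * s\<^sup>2"
    by (auto simp: field_simps)
  also have "\<dots> \<longleftrightarrow> l < exp (- pi * s\<^sup>2)"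
    using assms by (metis exp_less_cancel_iff exp_ln)
  finally show ?thesis .
qed

lemma gauss_radius_measurable [measurable]: "gauss_radius \<in> borel_measurable borel"
  unfolding gauss_radius_def by measurable

lemma gauss_radius_pos: "0 < l \<Longrightarrow> l < 1 \<Longrightarrow> 0 < gauss_radius l"
  unfolding gauss_radius_def by (simp add: field_simps)

lemma gaussian_layer_cake:
  "(\<integral>\<^sup>+l. indicator {0<..<1} l * indicator {s. \<bar>s\<bar> < gauss_radius l} s \<partial>lborel) = ennreal (exp (- pi * s\<^sup>2))"
proof -
  have "(\<integral>\<^sup>+l. indicator {0<..<1} l * indicator {s. \<bar>s\<bar> < gauss_radius l} s \<partial>lborel)
    = (\<integral>\<^sup>+l. indicator {0<..<exp (- pi * s\<^sup>2)} l \<partial>lborel)"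
  proof (rule nn_integral_cong)
    fix l :: real
    have "exp (- pi * s\<^sup>2) \<le> 1" by simp
    then have "l < 1" if "l < exp (- pi * s\<^sup>2)" using that by linarith
    then show "indicator {0<..<1} l * indicator {s. \<bar>s\<bar> < gauss_radius l} s
        = (indicator {0<..<exp (- pi * s\<^sup>2)} l :: ennreal)"
      using less_gauss_radius_iff[of l s] by (auto simp: indicator_def)
  qed
  also have "\<dots> = ennreal (exp (- pi * s\<^sup>2))" by simp
  finally show ?thesis .
qed

text \<open>The radius is the length of the nonnegative half of a superlevel interval. Exchanging
  the integrals over levels and points turns its mean into the Gaussian mass of the
  half-line.\<close>

lemma nn_integral_gauss_radius:
  "(\<integral>\<^sup>+l. indicator {0<..<1} l * ennreal (gauss_radius l) \<partial>lborel) = ennreal (1 / 2)"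
proof -
  have "indicator {0<..<1} l * ennreal (gauss_radius l) =
     (\<integral>\<^sup>+s. indicator {0<..<1} l * indicator {s. \<bar>s\<bar> < gauss_radius l} s * indicator {0..} s \<partial>lborel)" for l
  proof (cases "0 < l \<and> l < 1")
    case True
    have "(\<integral>\<^sup>+s. indicator {0<..<1} l * indicator {s. \<bar>s\<bar> < gauss_radius l} s * indicator {0..} s \<partial>lborel)
      = (\<integral>\<^sup>+s. indicator {0..<gauss_radius l} s \<partial>lborel)"
      using True by (intro nn_integral_cong) (auto simp: indicator_def)
    then show ?thesis using True gauss_radius_pos[of l] by simp
  qed (auto simp: indicator_def)
  then have "(\<integral>\<^sup>+l. indicator {0<..<1} l * ennreal (gauss_radius l) \<partial>lborel) =
     (\<integral>\<^sup>+l. \<integral>\<^sup>+s. indicator {0<..<1} l * indicator {s. \<bar>s\<bar> < gauss_radius l} s * indicator {0..} s \<partial>lborel \<partial>lborel)"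
    by simp
  also have "\<dots> = (\<integral>\<^sup>+s. \<integral>\<^sup>+l. indicator {0<..<1} l * indicator {s. \<bar>s\<bar> < gauss_radius l} s * indicator {0..} s \<partial>lborel \<partial>lborel)"
    by (rule lborel_pair.Fubini') measurable
  also have "\<dots> = (\<integral>\<^sup>+s. ennreal (exp (- pi * s\<^sup>2)) * indicator {0..} s \<partial>lborel)"
  proof (rule nn_integral_cong)
    fix s :: real
    show "(\<integral>\<^sup>+l. indicator {0<..<1} l * indicator {s. \<bar>s\<bar> < gauss_radius l} s * indicator {0..} s \<partial>lborel)
        = ennreal (exp (- pi * s\<^sup>2)) * indicator {0..} s"
      unfolding gaussian_layer_cake[symmetric] by (rule nn_integral_multc) measurable
  qed
  finally show ?thesis using nn_integral_gaussian_half_line by simp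
qed

text \<open>A slab of half-width 1/2 is more peaked than the Gaussian of the same mass: each Gaussian
  factor is a mixture of slabs of mean half-width 1/2, and the volume is concave in each half-width.\<close>

lemma gaussian_le_slab_body:
  fixes N :: "real^'n^'r"
  assumes inj: "inj ((*v) N)" and \<rho>: "\<And>j. 0 < \<rho> j"
  shows "(\<integral>\<^sup>+t. (\<Prod>j\<in>I. ennreal (exp (- pi * ((N *v t) $ j)\<^sup>2))) *
      (\<Prod>j\<in>-I. indicator {s. \<bar>s\<bar> < \<rho> j} ((N *v t) $ j)) \<partial>lborel)
    \<le> ennreal (measure lborel (slab_body N (\<lambda>j. if j \<in> I then 1 / 2 else \<rho> j)))"
proof -
  have "finite I" by simp
  then show ?thesis using \<rho>
  proof (induction I arbitrary: \<rho>)
    case empty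
    have "(\<Prod>j\<in>UNIV. indicator {s. \<bar>s\<bar> < \<rho> j} ((N *v t) $ j)) = (indicator (slab_body N \<rho>) t :: ennreal)" for t
      unfolding slab_body_def
      by (cases "\<forall>j. \<bar>(N *v t) $ j\<bar> < \<rho> j") (auto simp: indicator_def)
    moreover have "slab_body N \<rho> \<in> fmeasurable lborel"
      using bounded_slab_body[OF inj] open_slab_body by (intro bounded_open_fmeasurable)
    ultimately show ?case
      by (simp add: emeasure_eq_ennreal_measure fmeasurableD2 open_slab_body borel_open)
  next
    case (insert i I)
    let ?G = "\<lambda>J t. \<Prod>j\<in>J. ennreal (exp (- pi * ((N *v t) $ j)\<^sup>2))"
    let ?S = "\<lambda>J \<rho> t. \<Prod>j\<in>J. indicator {s. \<bar>s\<bar> < \<rho> j} ((N *v t) $ j) :: ennreal"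
    have lin [measurable]: "(\<lambda>t. (N *v t) $ j) \<in> borel_measurable borel" for j
      by (intro borel_measurable_continuous_onI continuous_intros
          linear_continuous_on_compose[of _ id, simplified] matrix_vector_mul_linear)
    define V where "V x = measure lborel (slab_body N ((\<lambda>j. if j \<in> I then 1 / 2 else \<rho> j)(i := x)))" for x
    obtain c where c: "0 \<le> c" "\<And>x. 0 < x \<Longrightarrow> V x \<le> V (1 / 2) + c * (x - 1 / 2)"
      using slab_body_supporting_line[OF inj, of "1 / 2" "\<lambda>j. if j \<in> I then 1 / 2 else \<rho> j" i]
      unfolding V_def by auto
    \<comment> \<open>The value at 0 of the supporting line to \<open>V\<close> at 1/2. Since
      \<open>V\<close> is nonnegative, the line is nonnegative for all positive arguments and hence
      at 0; this permits computing with it in \<open>ennreal\<close>.\<close>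
    define \<alpha> where "\<alpha> = V (1 / 2) - c / 2"
    have \<alpha>: "0 \<le> \<alpha>"
    proof (rule field_le_epsilon)
      fix e :: real assume e: "e > 0"
      define x where "x = e / (c + 1)"
      have x: "0 < x" "c * x \<le> e" using e c(1) unfolding x_def by (auto simp: field_simps)
      have "0 \<le> V x" unfolding V_def by simp
      then show "0 \<le> \<alpha> + e" using c(2)[of x] x unfolding \<alpha>_def by (simp add: algebra_simps)
    qed
    have I: "- I = insert i (- insert i I)" using insert by auto
    have "(\<integral>\<^sup>+t. ?G (insert i I) t * ?S (- insert i I) \<rho> t \<partial>lborel)
      = (\<integral>\<^sup>+t. \<integral>\<^sup>+l. indicator {0<..<1} l * indicator {s. \<bar>s\<bar> < gauss_radius l} ((N *v t) $ i)
            * (?G I t * ?S (- insert i I) \<rho> t) \<partial>lborel \<partial>lborel)"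
    proof (rule nn_integral_cong)
      fix t
      have "(\<integral>\<^sup>+l. indicator {0<..<1} l * indicator {s. \<bar>s\<bar> < gauss_radius l} ((N *v t) $ i)
            * (?G I t * ?S (- insert i I) \<rho> t) \<partial>lborel)
         = ennreal (exp (- pi * ((N *v t) $ i)\<^sup>2)) * (?G I t * ?S (- insert i I) \<rho> t)"
        unfolding gaussian_layer_cake[symmetric] by (rule nn_integral_multc) measurable
      then show "?G (insert i I) t * ?S (- insert i I) \<rho> t =
          (\<integral>\<^sup>+l. indicator {0<..<1} l * indicator {s. \<bar>s\<bar> < gauss_radius l} ((N *v t) $ i)
            * (?G I t * ?S (- insert i I) \<rho> t) \<partial>lborel)"
        using insert by (simp add: mult.assoc)
    qed
    also have "\<dots> = (\<integral>\<^sup>+l. \<integral>\<^sup>+t. indicator {0<..<1} l * indicator {s. \<bar>s\<bar> < gauss_radius l} ((N *v t) $ i)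
            * (?G I t * ?S (- insert i I) \<rho> t) \<partial>lborel \<partial>lborel)"
      by (rule lborel_pair.Fubini') measurable
    \<comment> \<open>For fixed \<open>l\<close> the Gaussian factor of row \<open>i\<close> has
      become a slab of half-width \<open>gauss_radius l\<close>, so the induction hypothesis applies
      with the half-width of \<open>i\<close> changed.\<close>
    also have "\<dots> = (\<integral>\<^sup>+l. indicator {0<..<1} l * (\<integral>\<^sup>+t. ?G I t * ?S (- I) (\<rho>(i := gauss_radius l)) t \<partial>lborel) \<partial>lborel)"
    proof (rule nn_integral_cong)
      fix l :: real
      have S: "?S (- I) (\<rho>(i := gauss_radius l)) t =
         indicator {s. \<bar>s\<bar> < gauss_radius l} ((N *v t) $ i) * ?S (- insert i I) \<rho> t" for t
        unfolding I by (subst prod.insert) (auto intro!: prod.cong)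
      show "(\<integral>\<^sup>+t. indicator {0<..<1} l * indicator {s. \<bar>s\<bar> < gauss_radius l} ((N *v t) $ i)
            * (?G I t * ?S (- insert i I) \<rho> t) \<partial>lborel)
        = indicator {0<..<1} l * (\<integral>\<^sup>+t. ?G I t * ?S (- I) (\<rho>(i := gauss_radius l)) t \<partial>lborel)"
        unfolding S by (subst nn_integral_cmult[symmetric]) (measurable, simp add: ac_simps)
    qed
    also have "\<dots> \<le> (\<integral>\<^sup>+l. indicator {0<..<1} l * ennreal \<alpha> + ennreal c * (indicator {0<..<1} l * ennreal (gauss_radius l)) \<partial>lborel)"
    proof (rule nn_integral_mono)
      fix l :: real
      show "indicator {0<..<1} l * (\<integral>\<^sup>+t. ?G I t * ?S (- I) (\<rho>(i := gauss_radius l)) t \<partial>lborel)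
         \<le> indicator {0<..<1} l * ennreal \<alpha> + ennreal c * (indicator {0<..<1} l * ennreal (gauss_radius l))"
      proof (cases "0 < l \<and> l < 1")
        case True
        then have r: "0 < gauss_radius l" using gauss_radius_pos by blast
        have e: "(\<lambda>j. if j \<in> I then 1 / 2 else (\<rho>(i := gauss_radius l)) j)
            = (\<lambda>j. if j \<in> I then 1 / 2 else \<rho> j)(i := gauss_radius l)"
          using insert by auto
        have "(\<integral>\<^sup>+t. ?G I t * ?S (- I) (\<rho>(i := gauss_radius l)) t \<partial>lborel) \<le> ennreal (V (gauss_radius l))"
          using insert.IH[of "\<rho>(i := gauss_radius l)"] insert.prems r unfolding e V_def by auto
        also have "\<dots> \<le> ennreal (\<alpha> + c * gauss_radius l)"
          using c(2)[OF r] unfolding \<alpha>_def by (intro ennreal_leI) (simp add: algebra_simps)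
        also have "\<dots> = ennreal \<alpha> + ennreal c * ennreal (gauss_radius l)"
          using \<alpha> c(1) r by (simp add: ennreal_plus ennreal_mult)
        finally show ?thesis using True by simp
      qed simp
    qed
    \<comment> \<open>Only the mean of the half-widths survives the integration of the line; it is
      1/2, the point where the line touches \<open>V\<close>.\<close>
    also have "\<dots> = ennreal \<alpha> + ennreal c * ennreal (1 / 2)"
      by (subst nn_integral_add, simp, simp, subst nn_integral_cmult, simp)
        (simp only: nn_integral_gauss_radius, simp add: nn_integral_multc)
    also have "\<dots> = ennreal (V (1 / 2))"
    proof -
      have "ennreal c * ennreal (1 / 2) = ennreal (c / 2)"
        using c(1) by (subst ennreal_mult[symmetric]) auto
      then have "ennreal \<alpha> + ennreal c * ennreal (1 / 2) = ennreal (\<alpha> + c / 2)"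
        using \<alpha> c(1) by (simp only:) (simp flip: ennreal_plus)
      then show ?thesis unfolding \<alpha>_def by simp
    qed
    also have "V (1 / 2) = measure lborel (slab_body N (\<lambda>j. if j \<in> insert i I then 1 / 2 else \<rho> j))"
      unfolding V_def by (intro arg_cong[where f = "\<lambda>\<rho>. measure lborel (slab_body N \<rho>)"]) auto
    finally show ?case .
  qed
qed

text \<open>Vaaler's inequality for the slabs given by \<open>N\<close>: all forms are taken
  Gaussian, so no factor with a prescribed half-width is left, and the value 1 supplied for the
  half-widths is a placeholder.\<close>

lemma slab_body_volume_ge:
  fixes N :: "real^'n^'r"
  assumes inj: "inj ((*v) N)"
  shows "1 / sqrt (det (transpose N ** N)) \<le> measure lborel (slab_body N (\<lambda>j. 1 / 2))"
proof -
  have "(norm (N *v t))\<^sup>2 = (\<Sum>j\<in>UNIV. ((N *v t) $ j)\<^sup>2)" for t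
    unfolding norm_vec_def L2_set_def by (simp add: sum_nonneg)
  then have "ennreal (exp (- pi * (norm (N *v t))\<^sup>2)) = (\<Prod>j\<in>UNIV. ennreal (exp (- pi * ((N *v t) $ j)\<^sup>2)))" for t
    by (simp add: prod_ennreal sum_distrib_left sum_negf flip: exp_sum)
  then have "ennreal (1 / sqrt (det (transpose N ** N))) \<le> ennreal (measure lborel (slab_body N (\<lambda>j. 1 / 2)))"
    using gaussian_le_slab_body[OF inj, of "\<lambda>_. 1" UNIV] nn_integral_gaussian_matrix(2)[OF inj]
    by simp
  then show ?thesis by (simp add: ennreal_le_iff)
qed

section \<open>From volume to integer points\<close>

text \<open>Cut \<open>E\<close> along the integer translates of the unit cube and move all pieces
  into one cube. If no two points differed by an integer vector, the moved pieces would be disjoint,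
  and the volume could not exceed 1.\<close>

lemma Blichfeldt:
  fixes E :: "(real^'n) set"
  assumes E: "E \<in> fmeasurable lborel" "1 < measure lborel E"
  obtains x y where "x \<in> E" "y \<in> E" "x \<noteq> y" "\<And>j. (x - y) $ j \<in> \<int>"
proof (rule ccontr)
  assume "\<not> thesis"
  with that have contr: "\<And>x y. x \<in> E \<Longrightarrow> y \<in> E \<Longrightarrow> (\<And>j. (x - y) $ j \<in> \<int>) \<Longrightarrow> x = y"
    by blast
  define w :: "int^'n \<Rightarrow> real^'n" where "w z = (\<chi> j. real_of_int (z $ j))" for z
  \<comment> \<open>Half-open, so that the integer translates partition the space exactly.\<close>
  define Q :: "(real^'n) set" where "Q = {x. \<forall>j. 0 \<le> x $ j \<and> x $ j < 1}"
  define P where "P z = {x. x + w z \<in> E \<and> x \<in> Q}" for z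
  have Qm: "Q \<in> sets borel"
    unfolding Q_def by measurable
  have Em: "E \<in> sets borel" using fmeasurableD[OF E(1)] by simp
  have vm: "{x. x + w z \<in> E} \<in> sets borel" for z
    using measurable_sets[of "\<lambda>x. x + w z" borel borel E] Em by (simp add: vimage_def)
  have Pm: "P z \<in> sets borel" for z
    unfolding P_def using vm[of z] Qm by (simp add: Collect_conj_eq)
  have disj: "disjoint_family P"
    unfolding disjoint_family_on_def
  proof (intro ballI impI equals0I)
    fix z z' x assume "z \<noteq> z'" "x \<in> P z \<inter> P z'"
    then have "x + w z \<in> E" "x + w z' \<in> E" unfolding P_def by auto
    then have "x + w z = x + w z'"
      by (rule contr) (simp add: w_def)
    then show False using \<open>z \<noteq> z'\<close> by (simp add: w_def vec_eq_iff)
  qed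
  have shift: "emeasure lborel (E \<inter> {x. x - w z \<in> Q}) = emeasure lborel (P z)" for z
  proof -
    have m: "E \<inter> {x. x - w z \<in> Q} \<in> sets borel"
      using measurable_sets[of "\<lambda>x. x - w z" borel borel Q] Qm Em by (simp add: vimage_def)
    have "emeasure lborel (E \<inter> {x. x - w z \<in> Q}) = emeasure (distr lborel borel ((+) (w z))) (E \<inter> {x. x - w z \<in> Q})"
      by (simp add: lborel_distr_plus)
    also have "\<dots> = emeasure lborel (P z)"
    proof -
      have "(+) (w z) -` (E \<inter> {x. x - w z \<in> Q}) = P z"
        unfolding P_def by (auto simp: add.commute)
      then show ?thesis using m by (simp add: emeasure_distr)
    qed
    finally show ?thesis .
  qed
  have cover: "E = (\<Union>z. E \<inter> {x. x - w z \<in> Q})"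
  proof -
    have "x - w (\<chi> j. \<lfloor>x $ j\<rfloor>) \<in> Q" for x
      unfolding Q_def w_def by (auto simp: algebra_simps) linarith
    then show ?thesis by blast
  qed
  have m: "E \<inter> {x. x - w z \<in> Q} \<in> sets lborel" for z
    using measurable_sets[of "\<lambda>x. x - w z" borel borel Q] Qm Em by (simp add: vimage_def)
  have dis: "disjoint_family (\<lambda>z. E \<inter> {x. x - w z \<in> Q})"
    unfolding disjoint_family_on_def
  proof (intro ballI impI equals0I)
    fix z z' x assume "z \<noteq> z'" "x \<in> (E \<inter> {x. x - w z \<in> Q}) \<inter> (E \<inter> {x. x - w z' \<in> Q})"
    then have "0 \<le> x $ j - real_of_int (z $ j)" "x $ j - real_of_int (z $ j) < 1"
       "0 \<le> x $ j - real_of_int (z' $ j)" "x $ j - real_of_int (z' $ j) < 1" for j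
      unfolding Q_def w_def by auto
    then have "z $ j = z' $ j" for j
      by (smt (verit, best) floor_unique)
    then show False using \<open>z \<noteq> z'\<close> by (simp add: vec_eq_iff)
  qed
  have "emeasure lborel E = (\<integral>\<^sup>+z. emeasure lborel (E \<inter> {x. x - w z \<in> Q}) \<partial>count_space UNIV)"
    by (subst cover) (rule emeasure_UN_countable[OF _ _ dis], use m in auto)
  also have "\<dots> = (\<integral>\<^sup>+z. emeasure lborel (P z) \<partial>count_space UNIV)"
    unfolding shift ..
  also have "\<dots> = emeasure lborel (\<Union>z. P z)"
    by (rule emeasure_UN_countable[OF _ _ disj, symmetric]) (use Pm in auto)
  also have "\<dots> \<le> emeasure lborel (cbox 0 (1 :: real^'n))"
    by (rule emeasure_mono) (auto simp: P_def Q_def mem_box_cart less_imp_le)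
  also have "\<dots> = 1"
  proof -
    have "1 \<bullet> b = 1" if "b \<in> Basis" for b :: "real^'n"
      using that by (auto simp: Basis_vec_def inner_axis)
    then show ?thesis by (subst emeasure_lborel_cbox) auto
  qed
  finally have "emeasure lborel E \<le> 1" .
  then have "measure lborel E \<le> 1"
    using E(1) by (simp add: emeasure_eq_measure2 ennreal_le_1)
  then show False using E(2) by simp
qed

text \<open>Two points with all forms below 1/2 in absolute value differ by less than 1 in every
  form. The strictness is what later forces integer-valued forms to vanish.\<close>

theorem nonzero_integer_point_in_slab_body:
  fixes N :: "real^'n^'r"
  assumes inj: "inj ((*v) N)" and det: "det (transpose N ** N) < 1"
  obtains t where "t \<noteq> 0" "\<And>j. t $ j \<in> \<int>" "\<And>i. \<bar>(N *v t) $ i\<bar> < 1"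
proof -
  let ?K = "slab_body N (\<lambda>_. 1 / 2)"
  have "1 < 1 / sqrt (det (transpose N ** N))"
    using det nn_integral_gaussian_matrix(1)[OF inj] by simp
  then have "1 < measure lborel ?K"
    using slab_body_volume_ge[OF inj] by linarith
  moreover have "?K \<in> fmeasurable lborel"
    using bounded_slab_body[OF inj] open_slab_body by (intro bounded_open_fmeasurable)
  ultimately obtain x y where xy: "x \<in> ?K" "y \<in> ?K" "x \<noteq> y" "\<And>j. (x - y) $ j \<in> \<int>"
    using Blichfeldt by metis
  show thesis
  proof (rule that)
    show "x - y \<noteq> 0" using xy by simp
    show "(x - y) $ j \<in> \<int>" for j using xy(4) .
    show "\<bar>(N *v (x - y)) $ i\<bar> < 1" for i
    proof -
      have "\<bar>(N *v x) $ i\<bar> < 1 / 2" "\<bar>(N *v y) $ i\<bar> < 1 / 2"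
        using xy(1,2) unfolding slab_body_def by auto
      then show ?thesis by (simp add: matrix_vector_mult_diff_distrib)
    qed
  qed
qed

section \<open>Sums of squared minors\<close>

text \<open>Each entry of the Gram matrix is a sum over rows of \<open>N\<close>. Expanding the
  product over \<open>i\<close> selects a row \<open>h i\<close> for each \<open>i\<close>, and the
  sum over permutations then reassembles a determinant.\<close>

lemma det_gram_eq_sum:
  fixes N :: "'a::comm_ring_1^'n^'r"
  shows "det (transpose N ** N) = (\<Sum>h\<in>UNIV. (\<Prod>i\<in>UNIV. N $ h i $ i) * det (\<chi> i. N $ h i :: 'a^'n^'n))"
proof -
  let ?P = "{p. p permutes (UNIV :: 'n set)}"
  have "(\<Prod>i\<in>UNIV. (transpose N ** N) $ i $ p i) =
      (\<Sum>h\<in>UNIV. (\<Prod>i\<in>UNIV. N $ h i $ i) * (\<Prod>i\<in>UNIV. N $ h i $ p i))" for p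
  proof -
    have "(\<Prod>i\<in>UNIV. (transpose N ** N) $ i $ p i) = (\<Prod>i\<in>UNIV. \<Sum>k\<in>UNIV. N $ k $ i * N $ k $ p i)"
      by (simp add: matrix_matrix_mult_def transpose_def)
    also have "\<dots> = (\<Sum>h\<in>PiE UNIV (\<lambda>_. UNIV). \<Prod>i\<in>UNIV. N $ h i $ i * N $ h i $ p i)"
      by (rule prod_sum_PiE) auto
    finally show ?thesis by (simp add: PiE_UNIV_domain prod.distrib)
  qed
  then have "det (transpose N ** N) =
      (\<Sum>p\<in>?P. \<Sum>h\<in>UNIV. (\<Prod>i\<in>UNIV. N $ h i $ i) * (of_int (sign p) * (\<Prod>i\<in>UNIV. N $ h i $ p i)))"
    unfolding det_def by (simp add: sum_distrib_left ac_simps)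
  also have "\<dots> = (\<Sum>h\<in>UNIV. \<Sum>p\<in>?P. (\<Prod>i\<in>UNIV. N $ h i $ i) * (of_int (sign p) * (\<Prod>i\<in>UNIV. N $ h i $ p i)))"
    by (rule sum.swap)
  finally show ?thesis unfolding det_def by (simp add: sum_distrib_left)
qed

text \<open>Expanding one of the two determinants gives one term per permutation, and reindexing
  \<open>h\<close> makes all these terms equal to the expansion of the Gram determinant.
  Noninjective \<open>h\<close> contribute 0, and each set of rows occurs once per ordering.\<close>

lemma Cauchy_Binet_gram:
  fixes N :: "'a::{comm_ring_1,ring_char_0}^'n^'r"
  shows "(\<Sum>h\<in>UNIV. (det (\<chi> i. N $ h i :: 'a^'n^'n))\<^sup>2) = fact CARD('n) * det (transpose N ** N)"
proof -
  let ?P = "{p. p permutes (UNIV :: 'n set)}"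
  let ?d = "\<lambda>h. det (\<chi> i. N $ h i :: 'a^'n^'n)"
  have "(\<Sum>h\<in>UNIV. (?d h)\<^sup>2) = (\<Sum>h\<in>UNIV. \<Sum>p\<in>?P. of_int (sign p) * (\<Prod>i\<in>UNIV. N $ h i $ p i) * ?d h)"
    by (simp add: power2_eq_square sum_distrib_right det_def[of "\<chi> i. N $ _ i"])
  also have "\<dots> = (\<Sum>p\<in>?P. \<Sum>h\<in>UNIV. of_int (sign p) * (\<Prod>i\<in>UNIV. N $ h i $ p i) * ?d h)"
    by (rule sum.swap)
  also have "\<dots> = (\<Sum>p\<in>?P. \<Sum>h\<in>UNIV. (\<Prod>i\<in>UNIV. N $ h i $ i) * ?d h)"
  proof (rule sum.cong)
    fix p assume "p \<in> ?P"
    then have p: "p permutes UNIV" by simp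
    \<comment> \<open>Composition with \<open>p\<close> permutes the rows of the minor; the
      resulting sign cancels the sign of the expansion.\<close>
    have bij: "bij_betw (\<lambda>h. h \<circ> p) (UNIV :: ('n \<Rightarrow> 'r) set) UNIV"
      using p by (intro bij_betwI[where g = "\<lambda>h. h \<circ> inv p"])
        (auto simp: fun_eq_iff permutes_inverses)
    have "(\<Sum>h\<in>UNIV. of_int (sign p) * (\<Prod>i\<in>UNIV. N $ h i $ p i) * ?d h)
      = (\<Sum>h\<in>UNIV. of_int (sign p) * (\<Prod>i\<in>UNIV. N $ (h \<circ> p) i $ p i) * ?d (h \<circ> p))"
      by (rule sum.reindex_bij_betw[OF bij, symmetric])
    also have "\<dots> = (\<Sum>h\<in>UNIV. (\<Prod>i\<in>UNIV. N $ h i $ i) * ?d h)"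
    proof (rule sum.cong)
      fix h :: "'n \<Rightarrow> 'r"
      have e1: "(\<Prod>i\<in>UNIV. N $ (h \<circ> p) i $ p i) = (\<Prod>i\<in>UNIV. N $ h i $ i)"
        using prod.permute[OF p, of "\<lambda>i. N $ h i $ i"] by (simp add: o_def)
      have e2: "?d (h \<circ> p) = of_int (sign p) * ?d h"
        using det_permute_rows[OF p, of "\<chi> i. N $ h i"] by simp
      have e3: "of_int (sign p) * of_int (sign p) = (1 :: 'a)"
        by (simp add: sign_idempotent flip: of_int_mult)
      have "of_int (sign p) * (\<Prod>i\<in>UNIV. N $ h i $ i) * (of_int (sign p) * ?d h)
         = of_int (sign p) * of_int (sign p) * ((\<Prod>i\<in>UNIV. N $ h i $ i) * ?d h)"
        by (simp only: ac_simps)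
      then show "of_int (sign p) * (\<Prod>i\<in>UNIV. N $ (h \<circ> p) i $ p i) * ?d (h \<circ> p)
         = (\<Prod>i\<in>UNIV. N $ h i $ i) * ?d h"
        unfolding e1 e2 e3 by simp
    qed simp
    finally show "(\<Sum>h\<in>UNIV. of_int (sign p) * (\<Prod>i\<in>UNIV. N $ h i $ p i) * ?d h)
      = (\<Sum>h\<in>UNIV. (\<Prod>i\<in>UNIV. N $ h i $ i) * ?d h)" .
  qed simp
  also have "\<dots> = fact CARD('n) * det (transpose N ** N)"
    by (simp add: card_permutations det_gram_eq_sum)
  finally show ?thesis .
qed

text \<open>The rows are changed one at a time. The rows outside \<open>K\<close> never change, so
  every added vector stays in the span of rows other than the current one.\<close>

lemma det_add_rows_span:
  fixes a x :: "'n \<Rightarrow> real^'n"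
  assumes "\<And>i. i \<in> K \<Longrightarrow> x i \<in> span (a ` (- K))"
  shows "det (\<chi> i. if i \<in> K then a i + x i else a i) = det (\<chi> i. a i)"
proof -
  have "det (\<chi> i. if i \<in> F then a i + x i else a i) = det (\<chi> i. a i)" if "finite F" "F \<subseteq> K" for F
    using that
  proof (induction F rule: finite_induct)
    case (insert k F)
    let ?M = "\<chi> i. if i \<in> F then a i + x i else a i"
    have row: "row j ?M = (if j \<in> F then a j + x j else a j)" for j
      by (simp add: row_def vec_eq_iff)
    have "a ` (- K) \<subseteq> {row j ?M |j. j \<noteq> k}"
      using insert.prems row by (auto; metis insert_subset subsetD)
    then have "x k \<in> vec.span {row j ?M |j. j \<noteq> k}"
      using assms[of k] insert.prems span_mono unfolding span_vec_eq by blast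
    then have "det (\<chi> i. if i = k then row k ?M + x k else row i ?M) = det ?M"
      by (rule det_row_span)
    moreover have "(\<chi> i. if i = k then row k ?M + x k else row i ?M)
       = (\<chi> i. if i \<in> insert k F then a i + x i else a i)"
      using insert.hyps by (auto simp: row vec_eq_iff)
    ultimately show ?case using insert by simp
  qed simp
  then show ?thesis by simp
qed

text \<open>The lattice of the points \<open>A t\<close> with \<open>A\<^sub>i t = 0\<close> off \<open>S\<close> is handled without passing to a
  lower-dimensional space: the rows in \<open>S\<close> are projected orthogonally to the span of the tight
  rows, which does not change their values on the integer points killed by the tight rows.\<close>

lemma minor_sum_lower_bound:
  fixes A :: "real^'n^'r" and S :: "'r set"
  assumes inj: "inj ((*v) A)" and int: "\<And>i j. A $ i $ j \<in> \<int>"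
    and none: "\<And>t. \<lbrakk>\<And>j. t $ j \<in> \<int>; \<And>i. i \<notin> S \<Longrightarrow> (A *v t) $ i = 0;
      \<And>i. i \<in> S \<Longrightarrow> \<bar>(A *v t) $ i\<bar> \<le> 1\<rbrakk> \<Longrightarrow> t = 0"
  obtains T where "T \<subseteq> - S" "card T \<le> CARD('n)" "CARD('n) \<le> card S + card T"
    "fact CARD('n) * 4 ^ (CARD('n) - card T) \<le>
      (\<Sum>h | inj h \<and> T \<subseteq> range h \<and> range h \<subseteq> S \<union> T. (det (\<chi> i. A $ h i :: real^'n^'n))\<^sup>2)"
proof -
  let ?n = "CARD('n)"
  obtain B where B: "B \<subseteq> ($) A ` (- S)" "independent B" "($) A ` (- S) \<subseteq> span B"
    using maximal_independent_subset[of "($) A ` (- S)"] by metis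
  have finB: "finite B" and cardB: "card B \<le> ?n"
    using independent_bound[OF B(2)] by auto
  \<comment> \<open>One row index for each vector of \<open>B\<close>; distinct indices off
    \<open>S\<close> may carry equal rows.\<close>
  define T where "T = inv_into (- S) (($) A) ` B"
  have T_sub: "T \<subseteq> - S" using B(1) unfolding T_def by (metis image_subsetI inv_into_into subsetD)
  have AT: "($) A ` T = B"
    unfolding T_def image_image using B(1) by (auto simp: f_inv_into_f subset_iff image_iff)
  have cardT: "card T = card B"
    unfolding T_def using B(1) by (intro card_image inj_on_inv_into)
  define l where "l = card T"
  have dimB: "dim (span B) = l"
    using dim_span_eq_card_independent[OF B(2)] cardT unfolding l_def by simp
  have "\<exists>y z. y \<in> span B \<and> (\<forall>w\<in>span B. orthogonal z w) \<and> A $ i = y + z" for i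
    using orthogonal_subspace_decomp_exists[of B "A $ i"] by metis
  then obtain p q where pq: "\<And>i. p i \<in> span B" "\<And>i w. w \<in> span B \<Longrightarrow> orthogonal (q i) w"
      "\<And>i. A $ i = p i + q i"
    by metis
  \<comment> \<open>Rows outside \<open>S \<union> T\<close> become zero: their values are already
    determined by the rows in \<open>T\<close>, and this confines the nonzero minors to
    \<open>S \<union> T\<close>.\<close>
  define N :: "real^'n^'r" where "N = (\<chi> i. if i \<in> T then A $ i else if i \<in> S then (1 / 2) *\<^sub>R q i else 0)"
  have NT: "(N *v t) $ i = (A *v t) $ i" if "i \<in> T" for i t
    using that unfolding N_def by (simp add: matrix_mult_dot)
  have NS: "(N *v t) $ i = (q i \<bullet> t) / 2" if "i \<in> S" for i t
    using that T_sub unfolding N_def by (auto simp: matrix_mult_dot)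
  have tight: "w \<bullet> t = 0" if "\<And>i. i \<in> T \<Longrightarrow> (A *v t) $ i = 0" "w \<in> span B" for t w
  proof -
    have "orthogonal t b" if "b \<in> B" for b
      using AT \<open>\<And>i. i \<in> T \<Longrightarrow> (A *v t) $ i = 0\<close> that
      by (auto simp: matrix_mult_dot orthogonal_def inner_commute)
    then show ?thesis
      using orthogonal_to_span[OF that(2), of t] by (simp add: orthogonal_def inner_commute)
  qed
  have tight_off: "(A *v t) $ i = 0" if "\<And>i. i \<in> T \<Longrightarrow> (A *v t) $ i = 0" "i \<notin> S" for t i
    using tight[OF that(1), of "A $ i"] B(3) that(2) by (auto simp: matrix_mult_dot)
  have tight_on: "(A *v t) $ i = q i \<bullet> t" if "\<And>i. i \<in> T \<Longrightarrow> (A *v t) $ i = 0" for t i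
    using tight[OF that pq(1)[of i]] pq(3)[of i] by (simp add: matrix_mult_dot inner_add_left)
  have injN: "inj ((*v) N)"
  proof -
    have "t = 0" if "N *v t = 0" for t
    proof -
      have T0: "(A *v t) $ i = 0" if "i \<in> T" for i
        using NT[OF that, of t] \<open>N *v t = 0\<close> by simp
      have "(A *v t) $ i = 0" for i
      proof (cases "i \<in> S")
        case True
        then show ?thesis using tight_on[OF T0, of i] NS[OF True, of t] that by simp
      qed (use tight_off[OF T0] in auto)
      then have "A *v t = 0" by (simp add: vec_eq_iff)
      then show "t = 0" using inj by (simp add: linear_injective_0)
    qed
    then show ?thesis by (simp add: linear_injective_0)
  qed
  have Aint: "(A *v t) $ i \<in> \<int>" if "\<And>j. t $ j \<in> \<int>" for t i
    using that int unfolding matrix_vector_mult_def by (auto intro!: Ints_sum Ints_mult)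
  have detN: "1 \<le> det (transpose N ** N)"
  proof (rule ccontr)
    assume "\<not> 1 \<le> det (transpose N ** N)"
    then obtain t where t: "t \<noteq> 0" "\<And>j. t $ j \<in> \<int>" "\<And>i. \<bar>(N *v t) $ i\<bar> < 1"
      using nonzero_integer_point_in_slab_body[OF injN] by (metis not_le)
    have T0: "(A *v t) $ i = 0" if "i \<in> T" for i
      using Aint[OF t(2), of i] t(3)[of i] NT[OF that] by (auto elim!: Ints_cases)
    have "t = 0"
    proof (rule none)
      show "(A *v t) $ i = 0" if "i \<notin> S" for i using tight_off[OF T0 that] .
      show "\<bar>(A *v t) $ i\<bar> \<le> 1" if "i \<in> S" for i
      proof -
        have "\<bar>(A *v t) $ i\<bar> < 2"
          using tight_on[OF T0, of i] NS[OF that, of t] t(3)[of i] by simp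
        moreover obtain z where z: "(A *v t) $ i = real_of_int z"
          using Aint[OF t(2), of i] by (auto elim!: Ints_cases)
        ultimately have "real_of_int \<bar>z\<bar> < real_of_int 2" by simp
        then have "\<bar>z\<bar> \<le> 1" unfolding of_int_less_iff by simp
        then show ?thesis unfolding z by (simp flip: of_int_abs)
      qed
    qed (fact t(2))
    then show False using t(1) by simp
  qed
  let ?H = "{h :: 'n \<Rightarrow> 'r. inj h \<and> T \<subseteq> range h \<and> range h \<subseteq> S \<union> T}"
  let ?N = "\<lambda>h. det (\<chi> i. N $ h i :: real^'n^'n)" and ?A = "\<lambda>h. det (\<chi> i. A $ h i :: real^'n^'n)"
  have zero: "?N h = 0" if "h \<notin> ?H" for h
  proof (cases "inj h \<and> range h \<subseteq> S \<union> T")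
    case False
    then consider i j where "i \<noteq> j" "h i = h j" | i where "h i \<notin> S \<union> T"
      unfolding inj_def by blast
    then show ?thesis
    proof cases
      case 1
      then show ?thesis by (intro det_identical_rows[of i j]) (auto simp: row_def)
    next
      case (2 i)
      then have "row i (\<chi> i. N $ h i) = 0" by (simp add: row_def N_def vec_eq_iff)
      then show ?thesis by (rule det_zero_row(2))
    qed
  next
    case True
    then have "\<not> T \<subseteq> range h" using that by auto
    \<comment> \<open>The rows chosen outside \<open>T\<close> lie in the orthogonal complement
      \<open>W\<close>, of dimension \<open>?n - l\<close>. With fewer than \<open>l\<close> rows
      from \<open>T\<close> the rank stays below \<open>?n\<close>.\<close>
    define W where "W = {y \<in> UNIV. \<forall>x\<in>span B. orthogonal x y}"
    have "dim W + dim (span B) = dim (UNIV :: (real^'n) set)"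
      unfolding W_def by (rule dim_subspace_orthogonal_to_vectors) (auto simp: subspace_span)
    then have dimW: "dim W = ?n - l" "l \<le> ?n" unfolding dimB by simp_all
    obtain C where C: "C \<subseteq> W" "independent C" "W \<subseteq> span C" "card C = dim W"
      by (rule basis_exists)
    have finC: "finite C" using independent_bound[OF C(2)] by auto
    let ?D = "($) A ` (T \<inter> range h) \<union> C"
    have "rows (\<chi> i. N $ h i) \<subseteq> span ?D"
    proof
      fix r assume "r \<in> rows (\<chi> i. N $ h i)"
      then obtain i where r: "r = N $ h i" unfolding rows_def by (auto simp: row_def)
      show "r \<in> span ?D"
      proof (cases "h i \<in> T")
        case True
        then show ?thesis unfolding r N_def by (intro span_base) auto
      next
        case nT: False
        then have "h i \<in> S" using True by auto
        moreover have "q (h i) \<in> W" using pq(2) unfolding W_def by (auto simp: orthogonal_commute)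
        then have "q (h i) \<in> span ?D" using C(3) span_mono[of C ?D] by auto
        ultimately show ?thesis using nT unfolding r N_def by (simp add: span_scale)
      qed
    qed
    then have "dim (rows (\<chi> i. N $ h i)) \<le> card ?D"
      using finC by (intro dim_le_card) auto
    also have "\<dots> \<le> card (($) A ` (T \<inter> range h)) + card C" by (rule card_Un_le)
    also have "card (($) A ` (T \<inter> range h)) \<le> card (T \<inter> range h)" by (rule card_image_le) simp
    also have "card (T \<inter> range h) < card T"
      using \<open>\<not> T \<subseteq> range h\<close> by (intro psubset_card_mono) auto
    finally have "rank (\<chi> i. N $ h i) < ?n"
      using C(4) dimW unfolding row_rank_def l_def by simp
    then show ?thesis by (simp add: det_eq_0_rank)
  qed
  \<comment> \<open>Since \<open>h\<close> uses all of \<open>T\<close>, the projections removed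
    from the rows in \<open>S\<close> lie in the span of rows of the same minor and can be added
    back. Only the factors 1/2 of the \<open>?n - l\<close> rows outside \<open>T\<close>
    remain.\<close>
  have scaled: "(?N h)\<^sup>2 * 4 ^ (?n - l) = (?A h)\<^sup>2" if "h \<in> ?H" for h
  proof -
    have h: "inj h" "T \<subseteq> range h" "range h \<subseteq> S \<union> T" using that by auto
    define K where "K = {i. h i \<notin> T}"
    have "card (- K) = card (h ` (- K))" using h(1) by (simp add: card_image inj_on_subset)
    also have "h ` (- K) = T" using h(2) unfolding K_def by auto
    finally have "card (- K) = l" unfolding l_def .
    moreover have "K = UNIV - (- K)" by auto
    ultimately have "card K = ?n - l"
      by (metis card_Diff_subset finite subset_UNIV)
    define a where "a i = (if i \<in> K then q (h i) else A $ h i)" for i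
    have aK: "a ` (- K) = B"
    proof -
      have "a ` (- K) = (\<lambda>i. A $ h i) ` (- K)" unfolding a_def by (intro image_cong) auto
      also have "\<dots> = ($) A ` (h ` (- K))" by (simp add: image_image)
      finally show ?thesis using AT \<open>h ` (- K) = T\<close> by simp
    qed
    have "(\<chi> i. N $ h i) = (\<chi> i. (if i \<in> K then 1 / 2 else 1) *s a i)"
      using h(3) unfolding N_def a_def K_def by (auto simp: vec_eq_iff)
    then have "?N h = (\<Prod>i\<in>UNIV. if i \<in> K then 1 / 2 else 1) * det (\<chi> i. a i)"
      by (simp only: det_rows_mul)
    also have "(\<Prod>i\<in>UNIV. if i \<in> K then 1 / 2 else 1 :: real) = (1 / 2) ^ (?n - l)"
      using \<open>card K = ?n - l\<close> by (simp add: prod.If_cases)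
    also have "det (\<chi> i. a i) = det (\<chi> i. if i \<in> K then a i + p (h i) else a i)"
      by (rule det_add_rows_span[symmetric]) (simp add: aK pq(1))
    also have "(\<chi> i. if i \<in> K then a i + p (h i) else a i) = (\<chi> i. A $ h i)"
      unfolding a_def using pq(3) by (auto simp: vec_eq_iff add.commute)
    finally show ?thesis
      by (simp add: power_mult_distrib power_divide power2_eq_square flip: power_mult_distrib)
  qed
  have "fact ?n * 4 ^ (?n - l) \<le> fact ?n * det (transpose N ** N) * 4 ^ (?n - l)"
    using detN by simp
  also have "\<dots> = (\<Sum>h\<in>UNIV. (?N h)\<^sup>2 * 4 ^ (?n - l))"
    by (simp add: sum_distrib_right flip: Cauchy_Binet_gram)
  also have "\<dots> = (\<Sum>h\<in>?H. (?N h)\<^sup>2 * 4 ^ (?n - l))"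
    by (rule sum.mono_neutral_right) (auto simp: zero)
  also have "\<dots> = (\<Sum>h\<in>?H. (?A h)\<^sup>2)"
    by (rule sum.cong) (auto simp: scaled)
  finally have main: "fact ?n * 4 ^ (?n - l) \<le> (\<Sum>h\<in>?H. (?A h)\<^sup>2)" .
  \<comment> \<open>The lower bound is positive, so the sum cannot be empty; an injective
    \<open>h\<close> with range in \<open>S \<union> T\<close> then bounds the dimension.\<close>
  have "?H \<noteq> {}"
  proof
    assume "?H = {}"
    then have "(\<Sum>h\<in>?H. (?A h)\<^sup>2) = 0" by (intro sum.neutral) blast
    then have "fact ?n * 4 ^ (?n - l) \<le> (0 :: real)" using main by linarith
    moreover have "0 < fact ?n * (4 :: real) ^ (?n - l)" by simp
    ultimately show False by linarith
  qed
  then obtain h :: "'n \<Rightarrow> 'r" where h: "inj h" "range h \<subseteq> S \<union> T" by auto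
  have "?n = card (range h)" using h(1) by (simp add: card_image)
  also have "\<dots> \<le> card (S \<union> T)" using h(2) by (intro card_mono) auto
  also have "\<dots> \<le> card S + card T" by (rule card_Un_le)
  finally have "?n \<le> card S + card T" .
  moreover have "card T \<le> ?n" using cardT cardB by simp
  ultimately show thesis using that T_sub main unfolding l_def by blast
qed

text \<open>Grouped by range \<open>J\<close>, there are at most \<open>fact CARD('n)\<close> maps
  for each \<open>J\<close>, and \<open>J\<close> is determined by its part in
  \<open>S\<close>.\<close>

lemma card_inj_prescribed_range:
  fixes S T :: "'r::finite set"
  assumes "S \<inter> T = {}" "card T \<le> CARD('n::finite)"
  shows "card {h :: 'n \<Rightarrow> 'r. inj h \<and> T \<subseteq> range h \<and> range h \<subseteq> S \<union> T}
    \<le> fact CARD('n) * (card S choose (CARD('n) - card T))"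
proof -
  let ?n = "CARD('n)"
  let ?J = "{J. T \<subseteq> J \<and> J \<subseteq> S \<union> T \<and> card J = ?n}"
  let ?B = "\<lambda>J. {h :: 'n \<Rightarrow> 'r. bij_betw h UNIV J}"
  have B: "card (?B J) \<le> fact ?n" for J
  proof (cases "?B J = {}")
    case False
    then obtain h0 :: "'n \<Rightarrow> 'r" where h0: "bij_betw h0 UNIV J" by auto
    have "?B J \<subseteq> (\<lambda>p. h0 \<circ> p) ` {p. p permutes UNIV}"
    proof
      fix h assume "h \<in> ?B J"
      then have h: "bij_betw h UNIV J" by simp
      let ?p = "\<lambda>i. inv_into UNIV h0 (h i)"
      have "bij_betw (inv_into UNIV h0 \<circ> h) UNIV UNIV"
        using h h0 by (intro bij_betw_trans bij_betw_inv_into)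
      then have "?p permutes UNIV" by (intro bij_imp_permutes) (auto simp: o_def)
      moreover have "h = h0 \<circ> ?p"
        using h h0 by (auto simp: fun_eq_iff bij_betw_def f_inv_into_f)
      ultimately show "h \<in> (\<lambda>p. h0 \<circ> p) ` {p. p permutes UNIV}" by blast
    qed
    then have "card (?B J) \<le> card {p. p permutes (UNIV :: 'n set)}"
      by (rule surj_card_le[rotated]) simp
    then show ?thesis by (simp add: card_permutations)
  qed simp
  have "{h :: 'n \<Rightarrow> 'r. inj h \<and> T \<subseteq> range h \<and> range h \<subseteq> S \<union> T} \<subseteq> (\<Union>J\<in>?J. ?B J)"
  proof
    fix h :: "'n \<Rightarrow> 'r" assume "h \<in> {h. inj h \<and> T \<subseteq> range h \<and> range h \<subseteq> S \<union> T}"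
    then have "range h \<in> ?J" "h \<in> ?B (range h)"
      by (auto simp: card_image bij_betw_def)
    then show "h \<in> (\<Union>J\<in>?J. ?B J)" by blast
  qed
  then have "card {h :: 'n \<Rightarrow> 'r. inj h \<and> T \<subseteq> range h \<and> range h \<subseteq> S \<union> T} \<le> card (\<Union>J\<in>?J. ?B J)"
    by (intro card_mono) auto
  also have "\<dots> \<le> (\<Sum>J\<in>?J. card (?B J))" by (rule card_UN_le) simp
  also have "\<dots> \<le> (\<Sum>J\<in>?J. fact ?n)" by (rule sum_mono) (rule B)
  also have "\<dots> = fact ?n * card ?J" by simp
  also have "card ?J \<le> card {K. K \<subseteq> S \<and> card K = ?n - card T}"
  proof (rule card_inj_on_le[where f = "\<lambda>J. J - T"])
    show "inj_on (\<lambda>J. J - T) ?J" by (auto simp: inj_on_def)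
    show "(\<lambda>J. J - T) ` ?J \<subseteq> {K. K \<subseteq> S \<and> card K = ?n - card T}"
      by (auto simp: card_Diff_subset)
  qed simp
  also have "\<dots> = card S choose (?n - card T)" by (rule n_subsets) simp
  finally show ?thesis by simp
qed

section \<open>Numerical estimates\<close>

text \<open>The ninth power of e is about 8103, just below \<open>2 ^ 13\<close>, which is
  8192.\<close>

lemma log2_exp_1_less: "log 2 (exp 1) \<le> 13 / 9" "log 2 (exp 1) < exp 1"
proof -
  have e: "exp 1 \<le> (271829 / 100000 :: real)" "(271828 / 100000 :: real) \<le> exp 1"
    using e_approx_32 unfolding abs_le_iff by simp_all
  have "exp 1 ^ 9 \<le> (271829 / 100000 :: real) ^ 9"
    using e by (intro power_mono) auto
  also have "\<dots> \<le> 2 ^ 13" by (simp add: power_divide)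
  finally have "log 2 (exp 1 ^ 9) \<le> log 2 (2 ^ 13)"
    by (subst log_le_cancel_iff) auto
  moreover have "log 2 (exp 1 ^ 9) = 9 * log 2 (exp 1)" "log 2 (2 ^ 13) = (13 :: real)"
    by (subst log_nat_power; simp)+
  ultimately show "log 2 (exp 1) \<le> 13 / 9" by linarith
  then show "log 2 (exp 1) < exp 1" using e by linarith
qed

lemma log_sqrt: "0 < x \<Longrightarrow> log a (sqrt x) = log a x / 2"
  by (simp add: log_def ln_sqrt)

text \<open>Doubling 2.27 - 1/2 gives 3.54 = 177/50, and 2 to this power is slightly above 11.63.
  The quotient under the root is about 11.59, so the rational bounds for e and 13/9 for its binary
  logarithm are precise enough.\<close>

lemma support_constant_le:
  "log 2 (sqrt (2 * (exp 1)\<^sup>2 / (exp 1 - log 2 (exp 1)))) + 1 / 2 \<le> (2.27 :: real)"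
proof -
  let ?e = "exp 1 :: real" and ?l = "log 2 (exp 1) :: real"
  have e: "?e \<le> 271829 / 100000" "271828 / 100000 \<le> ?e"
    using e_approx_32 unfolding abs_le_iff by simp_all
  have pos: "0 < ?e - ?l" using log2_exp_1_less by simp
  have "2 * ?e\<^sup>2 \<le> 2 * (271829 / 100000)\<^sup>2"
    using e by (intro mult_left_mono power_mono) auto
  also have "\<dots> \<le> 11.63 * (271828 / 100000 - 13 / 9)" by (simp add: power_divide)
  also have "\<dots> \<le> 11.63 * (?e - ?l)"
    using e log2_exp_1_less by (intro mult_left_mono) auto
  finally have R: "2 * ?e\<^sup>2 / (?e - ?l) \<le> 11.63"
    using pos by (simp add: field_simps)
  have "real 50 * log 2 11.63 = log 2 (11.63 ^ 50)" by (subst log_nat_power) auto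
  also have "\<dots> \<le> log 2 (2 ^ 177)" by (subst log_le_cancel_iff) (auto simp: power_divide)
  also have "\<dots> = 177" by (subst log_nat_power) auto
  finally have "log 2 11.63 \<le> 3.54" by simp
  moreover have "log 2 (sqrt (2 * ?e\<^sup>2 / (?e - ?l))) = log 2 (2 * ?e\<^sup>2 / (?e - ?l)) / 2"
    using pos by (subst log_sqrt) auto
  moreover have "log 2 (2 * ?e\<^sup>2 / (?e - ?l)) \<le> log 2 11.63"
    using pos R by (subst log_le_cancel_iff) auto
  ultimately show ?thesis by simp
qed

text \<open>One term of the expansion of \<open>(x + 1) ^ k\<close> at \<open>x = m / k\<close>,
  where the whole sum is at most \<open>exp 1 ^ m\<close>. As \<open>x\<close> is at most 1, the
  exponent \<open>j\<close> may be raised to \<open>m\<close>.\<close>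

lemma binomial_le_exp_power:
  assumes "j \<le> m" "0 < m" "m \<le> k"
  shows "real (k choose j) \<le> (exp 1 * real k / real m) ^ m"
proof -
  define x where "x = real m / real k"
  have x: "0 < x" "x \<le> 1" using assms unfolding x_def by auto
  have "real (k choose j) * x ^ m \<le> real (k choose j) * x ^ j"
    using x assms by (intro mult_left_mono power_decreasing) auto
  also have "\<dots> \<le> (\<Sum>i\<le>k. real (k choose i) * x ^ i)"
    using x assms by (intro member_le_sum[of j "{..k}" "\<lambda>i. real (k choose i) * x ^ i"]) auto
  also have "\<dots> = (x + 1) ^ k" by (simp add: binomial_ring)
  also have "\<dots> \<le> exp x ^ k"
    using x exp_ge_add_one_self[of x] by (intro power_mono) (auto simp: add.commute)
  also have "\<dots> = exp 1 ^ m"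
    using assms unfolding x_def by (simp flip: exp_of_nat_mult)
  finally have "real (k choose j) * x ^ m / x ^ m \<le> exp 1 ^ m / x ^ m"
    using x by (intro divide_right_mono) auto
  then show ?thesis using x assms unfolding x_def by (simp add: power_divide power_mult_distrib)
qed

text \<open>The tangent to the logarithm at e passes through the origin.\<close>

lemma log2_le_linear:
  assumes "0 < w"
  shows "log 2 w \<le> log 2 (exp 1) / exp 1 * w"
proof -
  have "ln (w / exp 1) \<le> w / exp 1 - 1"
    using assms by (intro ln_le_minus_one) auto
  then have "ln w \<le> w / exp 1" using assms by (simp add: ln_div)
  then have "ln w / ln 2 \<le> w / exp 1 / ln 2" by (intro divide_right_mono) auto
  then show ?thesis by (simp add: log_def mult.commute)
qed

text \<open>With \<open>x = k / m\<close> the hypothesis reads \<open>x - log\<^sub>2 (2 x) / 2 \<le> y\<close>. Bounding the logarithm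
  by its tangent through the origin gives a linear bound on \<open>x\<close> in terms of \<open>y\<close>, which is
  substituted back into the logarithm.\<close>

lemma support_bound_numeric:
  fixes \<Delta> c :: real and d k m :: nat
  assumes \<Delta>: "1 \<le> \<Delta>" and m: "1 \<le> m" and d: "d \<le> k" "k \<le> d + m"
    and main: "4 ^ d \<le> real (k choose d) * \<Delta>\<^sup>2"
    and c: "c = log 2 (sqrt (2 * (exp 1)\<^sup>2 / (exp 1 - log 2 (exp 1)))) + 1 / 2"
  shows "real k \<le> c * real m + log 2 \<Delta>
           + real m / 2 * log 2 (log 2 (sqrt (2 * exp 1)) + log 2 \<Delta> / real m)"
proof -
  define e where "e = (exp 1 :: real)"
  define l where "l = log 2 e"
  define L where "L = log 2 \<Delta>"
  define y where "y = log 2 (sqrt (2 * exp 1)) + L / real m"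
  have e: "0 < e" "1 < e" unfolding e_def by auto
  have le: "0 < l" "l < e" unfolding l_def e_def using log2_exp_1_less by auto
  have l1: "1 \<le> l"
  proof -
    have "(2 :: real) \<le> exp 1" using exp_ge_add_one_self[of 1] by simp
    then have "log 2 2 \<le> log 2 e" unfolding e_def by (subst log_le_cancel_iff) auto
    then show ?thesis unfolding l_def by simp
  qed
  have L: "0 \<le> L" unfolding L_def using \<Delta> by simp
  have \<kappa>: "log 2 (sqrt (2 * exp 1)) = 1 / 2 + l / 2"
    unfolding l_def e_def by (subst log_sqrt) (auto simp: log_mult)
  have "0 \<le> L / real m" using L by simp
  then have y1: "1 \<le> y" unfolding y_def \<kappa> using l1 by linarith
  have cl: "c = 1 + l - log 2 (e - l) / 2"
  proof -
    have "log 2 (2 * e\<^sup>2 / (e - l)) = log 2 2 + (l + l) - log 2 (e - l)"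
      using e le by (simp add: log_divide log_mult power2_eq_square l_def)
    then show ?thesis
      unfolding c using le e by (simp add: log_sqrt add_divide_distrib diff_divide_distrib flip: e_def l_def)
  qed
  have "real k \<le> c * real m + L + real m / 2 * log 2 y"
  proof (cases "k < m")
    \<comment> \<open>Here the term \<open>c * real m\<close> suffices, because \<open>c\<close> and
      \<open>y\<close> are at least 1. The binomial estimate below is for \<open>m\<close> at most
      \<open>k\<close>.\<close>
    case True
    have "log 2 (e - l) \<le> log 2 e"
      using e le by (subst log_le_cancel_iff) auto
    then have "1 \<le> c" unfolding cl l_def[symmetric] using l1 by simp
    then have "1 * real m \<le> c * real m" by (rule mult_right_mono) simp
    then have "real k \<le> c * real m" using True by linarith
    moreover have "0 \<le> real m / 2 * log 2 y" using y1 by simp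
    ultimately show ?thesis using L by linarith
  next
    case False
    define x where "x = real k / real m"
    have x: "0 < x" using False m unfolding x_def by simp
    \<comment> \<open>The complementary index \<open>k - d\<close> is at most \<open>m\<close>, so
      the binomial coefficient is bounded by an \<open>m\<close>-th power.\<close>
    have "k choose d = k choose (k - d)" using d(1) by (rule binomial_symmetric)
    then have "4 ^ d \<le> (e * real k / real m) ^ m * \<Delta>\<^sup>2"
      using main binomial_le_exp_power[of "k - d" m k] False m d
        mult_right_mono[of "real (k choose (k - d))" "(e * real k / real m) ^ m" "\<Delta>\<^sup>2"]
      unfolding e_def by fastforce
    also have "e * real k / real m = e * x" unfolding x_def by simp
    finally have "log 2 (4 ^ d) \<le> log 2 ((e * x) ^ m * \<Delta>\<^sup>2)"
      using e x \<Delta> by (subst log_le_cancel_iff) auto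
    also have "\<dots> = real m * (l + log 2 x) + 2 * L"
      using e x \<Delta> by (simp add: log_mult log_nat_power l_def L_def)
    also have "log 2 (4 ^ d) = 2 * real d"
    proof -
      have "(4 :: real) ^ d = 2 ^ (2 * d)" by (simp add: power_mult)
      then show ?thesis by (simp add: log_nat_power)
    qed
    finally have "real k \<le> real m + L + real m * (l + log 2 x) / 2" using d by linarith
    then have "real k / real m \<le> (real m + L + real m * (l + log 2 x) / 2) / real m"
      by (rule divide_right_mono) simp
    also have "\<dots> = 1 + L / real m + (l + log 2 x) / 2"
      using m by (simp add: add_divide_distrib)
    finally have xb: "x \<le> 1 / 2 + y + log 2 x / 2"
      unfolding x_def[symmetric] y_def \<kappa> by (simp add: add_divide_distrib)
    define q where "q = l / e"
    have "1 + log 2 x \<le> q * (2 * x)"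
      using log2_le_linear[of "2 * x"] x unfolding q_def e_def l_def by (simp add: log_mult)
    then have "x * (1 - q) \<le> y"
      using xb by (simp add: algebra_simps)
    moreover have "1 - q = (e - l) / e" unfolding q_def using e by (simp add: diff_divide_distrib)
    ultimately have "x \<le> y * e / (e - l)"
      using e le by (simp add: field_simps)
    then have "log 2 x \<le> log 2 (y * e / (e - l))"
      using x y1 e le by (subst log_le_cancel_iff) auto
    also have "\<dots> = log 2 y + l - log 2 (e - l)"
      using y1 e le by (simp add: log_divide log_mult l_def)
    \<comment> \<open>The constants 1/2 from \<open>xb\<close>, \<open>1 / 2 + l / 2\<close> inside
      \<open>y\<close>, and half of \<open>l - log 2 (e - l)\<close> add up to exactly
      \<open>c\<close>.\<close>
    finally have "x \<le> c + L / real m + log 2 y / 2"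
      using xb unfolding cl y_def \<kappa> by (simp add: field_simps)
    then have "x * real m \<le> (c + L / real m + log 2 y / 2) * real m"
      by (rule mult_right_mono) simp
    then show ?thesis using m unfolding x_def by (simp add: algebra_simps)
  qed
  then show ?thesis unfolding y_def L_def .
qed

section \<open>Sparsity of the vertex in a normalized system\<close>

text \<open>The index type carries no order, so triangularity is read through the injective
  numbering \<open>g\<close>. A permutation that nowhere increases \<open>g\<close> preserves its
  sum, hence every value of \<open>g\<close>, and is the identity.\<close>

lemma det_lower_triangular_wrt:
  fixes X :: "'a::comm_ring_1^'n^'n" and g :: "'n \<Rightarrow> nat"
  assumes g: "inj g" and X: "\<And>i j. g i < g j \<Longrightarrow> X $ i $ j = 0"
  shows "det X = (\<Prod>i\<in>UNIV. X $ i $ i)"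
proof -
  have zero: "(\<Prod>i\<in>UNIV. X $ i $ p i) = 0" if p: "p permutes UNIV" "p \<noteq> id" for p
  proof -
    have "\<exists>i. g i < g (p i)"
    proof (rule ccontr)
      assume "\<nexists>i. g i < g (p i)"
      then have le: "\<And>i. g (p i) \<le> g i" by (simp add: not_less)
      have "(\<Sum>i\<in>UNIV. g (p i)) = (\<Sum>i\<in>UNIV. g i)"
        using sum.permute[OF p(1), of g] by (simp add: o_def)
      then have "g (p i) = g i" for i
        using sum_mono_inv[of "\<lambda>i. g (p i)" UNIV g i] le by simp
      then have "p = id" using g by (auto simp: fun_eq_iff inj_eq)
      then show False using p(2) by simp
    qed
    then show ?thesis using X by (metis UNIV_I finite prod_zero)
  qed
  have "det X = (\<Sum>p\<in>{id}. of_int (sign p) * (\<Prod>i\<in>UNIV. X $ i $ p i))"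
    unfolding det_def by (rule sum.mono_neutral_right) (auto simp: permutes_id zero)
  then show ?thesis by simp
qed

text \<open>In the identity block the right-hand side lies in the range from 0 to below 1, hence is
  0, and the row is a unit vector; so slack and coordinate agree up to sign. The other coordinates
  number \<open>n - s\<close>, and each contributes a diagonal factor of at least 2 to the
  determinant.\<close>

lemma norm0_le_of_normalized:
  fixes A :: "int^'n^'r" and b :: "int^'r" and v :: "real^'n"
  assumes norm: "normalized A b B" and h: "bij_betw h UNIV B"
  defines "u \<equiv> real_vec b - real_mat A *v v"
  shows "real (norm0 v) \<le> real (norm0 u) + log 2 (real_of_int \<bar>det (row_submatrix A h)\<bar>)"
proof -
  let ?n = "CARD('n)"
  obtain s p q where s: "s \<le> ?n" and p: "bij_betw p {..<?n} B" and q: "bij_betw q {..<?n} (UNIV :: 'n set)"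
    and shape: "\<forall>i<s. \<forall>j<s. A $ p i $ q j = (if i = j then 1 else 0)"
      "\<forall>i<?n. \<forall>j<?n. i < j \<longrightarrow> A $ p i $ q j = 0"
      "\<forall>i<?n. s \<le> i \<longrightarrow> 2 \<le> A $ p i $ q i"
    and b: "\<forall>i<?n. 0 \<le> b $ p i \<and> b $ p i < A $ p i $ q i"
    using norm unfolding normalized_def Let_def by (elim exE conjE) (rule that)
  have id: "A $ p i $ q j = (if i = j then 1 else 0)" if "i < s" "j < s" for i j
    using shape(1) that by blast
  have tri: "A $ p i $ q j = 0" if "i < j" "j < ?n" for i j
    using shape(2) that order.strict_trans by blast
  have diag: "2 \<le> A $ p i $ q i" if "s \<le> i" "i < ?n" for i
    using shape(3) that by blast
  define g where "g = inv_into {..<?n} q"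
  have g: "bij_betw g UNIV {..<?n}" unfolding g_def by (rule bij_betw_inv_into[OF q])
  have qg: "q (g j) = j" for j
    unfolding g_def using q by (meson UNIV_I bij_betw_inv_into_right)
  have g_less: "g j < ?n" for j using g by (auto simp: bij_betw_def)
  define X where "X = row_submatrix A (\<lambda>i. p (g i))"
  have X: "X $ i $ j = A $ p (g i) $ q (g j)" for i j
    unfolding X_def row_submatrix_def by (simp add: qg)
  have "det X = (\<Prod>i\<in>UNIV. X $ i $ i)"
    using g g_less by (intro det_lower_triangular_wrt[of g]) (auto simp: X tri bij_betw_def)
  also have "\<dots> = (\<Prod>i<?n. A $ p i $ q i)"
    unfolding X by (rule prod.reindex_bij_betw[OF g])
  also have "\<dots> = (\<Prod>i<s. A $ p i $ q i) * (\<Prod>i\<in>{s..<?n}. A $ p i $ q i)"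
    using s by (subst prod.union_disjoint[symmetric]) (auto intro!: prod.cong)
  also have "(\<Prod>i<s. A $ p i $ q i) = 1" by (rule prod.neutral) (simp add: id)
  finally have detX: "det X = (\<Prod>i\<in>{s..<?n}. A $ p i $ q i)" by simp
  have "(2 :: int) ^ (?n - s) = (\<Prod>i\<in>{s..<?n}. 2)" by simp
  also have "\<dots> \<le> det X" unfolding detX by (rule prod_mono) (auto simp: diag)
  finally have X2: "2 ^ (?n - s) \<le> det X" .
  have pg: "bij_betw (\<lambda>i. p (g i)) UNIV B"
    using bij_betw_trans[OF g p] by (simp add: o_def)
  \<comment> \<open>Two enumerations of \<open>B\<close> differ by a permutation of the rows, which
    changes at most the sign of the determinant.\<close>
  define \<pi> where "\<pi> = inv_into UNIV (\<lambda>i. p (g i)) \<circ> h"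
  have "bij_betw \<pi> UNIV UNIV"
    unfolding \<pi>_def by (rule bij_betw_trans[OF h bij_betw_inv_into[OF pg]])
  then have \<pi>: "\<pi> permutes UNIV" by (intro bij_imp_permutes) auto
  have "p (g (\<pi> i)) = h i" for i
    unfolding \<pi>_def o_def using pg h by (metis UNIV_I bij_betwE bij_betw_inv_into_right)
  then have "row_submatrix A h = (\<chi> i. X $ \<pi> i)"
    unfolding X_def row_submatrix_def by simp
  then have "\<bar>det (row_submatrix A h)\<bar> = \<bar>det X\<bar>"
    using det_permute_rows[OF \<pi>, of X] by (simp add: abs_mult sign_def)
  then have "2 ^ (?n - s) \<le> \<bar>det (row_submatrix A h)\<bar>"
    using X2 by simp
  moreover from this have "0 < \<bar>det (row_submatrix A h)\<bar>"
    by (rule less_le_trans[rotated]) simp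
  ultimately have pos: "0 < real_of_int \<bar>det (row_submatrix A h)\<bar>"
      and "real_of_int (2 ^ (?n - s)) \<le> real_of_int \<bar>det (row_submatrix A h)\<bar>"
    unfolding of_int_le_iff of_int_0_less_iff by blast+
  then have "log 2 (2 ^ (?n - s)) \<le> log 2 (real_of_int \<bar>det (row_submatrix A h)\<bar>)"
    using pos by (subst log_le_cancel_iff) auto
  then have log_ge: "real (?n - s) \<le> log 2 (real_of_int \<bar>det (row_submatrix A h)\<bar>)"
    by (simp add: log_nat_power)
  have u: "u $ p i = - v $ q i" if "i < s" for i
  proof -
    have "b $ p i = 0" using b[rule_format, of i] id[OF that that] that s by auto
    moreover have "(real_mat A *v v) $ p i = v $ q i"
    proof -
      have "(real_mat A *v v) $ p i = (\<Sum>j\<in>UNIV. real_of_int (A $ p i $ j) * v $ j)"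
        by (simp add: matrix_vector_mult_def map_matrix_def)
      also have "\<dots> = (\<Sum>k<?n. real_of_int (A $ p i $ q k) * v $ q k)"
        by (rule sum.reindex_bij_betw[OF q, symmetric])
      also have "\<dots> = (\<Sum>k<?n. if k = i then v $ q k else 0)"
      proof (rule sum.cong)
        fix k assume "k \<in> {..<?n}"
        then show "real_of_int (A $ p i $ q k) * v $ q k = (if k = i then v $ q k else 0)"
          using that id[OF that, of k] tri[of i k] by (cases "k < s") auto
      qed simp
      also have "\<dots> = v $ q i" using that s by simp
      finally show ?thesis .
    qed
    ultimately show ?thesis unfolding u_def real_vec_def by simp
  qed
  have "{j. v $ j \<noteq> 0} \<subseteq> q ` {i. i < s \<and> u $ p i \<noteq> 0} \<union> q ` {s..<?n}"
  proof
    fix j assume "j \<in> {j. v $ j \<noteq> 0}"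
    then show "j \<in> q ` {i. i < s \<and> u $ p i \<noteq> 0} \<union> q ` {s..<?n}"
      using u[of "g j"] qg[of j] g_less[of j]
      by (cases "g j < s") (auto intro!: image_eqI[of j q "g j"])
  qed
  then have "norm0 v \<le> card (q ` {i. i < s \<and> u $ p i \<noteq> 0} \<union> q ` {s..<?n})"
    unfolding norm0_def by (intro card_mono) auto
  also have "\<dots> \<le> card (q ` {i. i < s \<and> u $ p i \<noteq> 0}) + card (q ` {s..<?n})"
    by (rule card_Un_le)
  also have "card (q ` {s..<?n}) \<le> ?n - s"
    by (rule order_trans[OF card_image_le]) auto
  also have "card (q ` {i. i < s \<and> u $ p i \<noteq> 0}) \<le> card {i. i < s \<and> u $ p i \<noteq> 0}"
    by (rule card_image_le) simp
  also have "card {i. i < s \<and> u $ p i \<noteq> 0} \<le> norm0 u"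
    unfolding norm0_def
  proof (rule card_inj_on_le[where f = p])
    show "inj_on p {i. i < s \<and> u $ p i \<noteq> 0}"
      using p s by (auto simp: bij_betw_def intro: inj_on_subset)
  qed auto
  finally have "norm0 v \<le> norm0 u + (?n - s)" by simp
  then show ?thesis using log_ge by linarith
qed

section \<open>Vertices of the integer hull\<close>

lemma det_map_of_int: "det (real_mat X) = real_of_int (det X)"
  unfolding det_def by (simp add: map_matrix_def)

lemma rows_real_mat: "(\<chi> i. real_mat A $ h i) = real_mat (\<chi> i. A $ h i)"
  by (simp add: map_matrix_def vec_eq_iff)

lemma gram_real_mat: "transpose (real_mat A) ** real_mat A = real_mat (transpose A ** A)"
  by (simp add: map_matrix_def vec_eq_iff matrix_matrix_mult_def transpose_def)

text \<open>At full column rank the whole column set is admissible for \<open>J\<close>, and then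
  the bordering disappears.\<close>

lemma abs_det_rows_le_max_subdet:
  fixes A :: "int^'n^'r"
  assumes "rank (real_mat A) = CARD('n)" "inj h"
  shows "\<bar>det (\<chi> i. A $ h i)\<bar> \<le> max_subdet A"
proof -
  have "{\<bar>subdet A J h\<bar> | J h. card J = rank (real_mat A) \<and> inj_on h J}
      \<subseteq> (\<lambda>(J, h). \<bar>subdet A J h\<bar>) ` UNIV"
    by auto
  then have "finite {\<bar>subdet A J h\<bar> | J h. card J = rank (real_mat A) \<and> inj_on h J}"
    by (rule finite_subset) simp
  moreover have "subdet A UNIV h = det (\<chi> i. A $ h i)"
    unfolding subdet_def by (simp add: vec_eq_iff cong: if_cong)
  ultimately show ?thesis
    unfolding max_subdet_def using assms by (intro Max_ge) (auto intro!: exI[of _ UNIV] exI[of _ h])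
qed

text \<open>An extreme point of a convex hull belongs to the generating set, so \<open>v\<close> is
  an integer point and its slacks are integers. A nonzero slack is thus at least 1 and leaves room
  for both \<open>v + t\<close> and \<open>v - t\<close>.\<close>

lemma integer_hull_vertex:
  fixes A :: "int^'n^'r" and v :: "real^'n"
  assumes v: "v extreme_point_of integer_hull A b"
    and t: "\<And>j. t $ j \<in> \<int>"
    and tight: "\<And>i. (real_vec b - real_mat A *v v) $ i = 0 \<Longrightarrow> (real_mat A *v t) $ i = 0"
    and slack: "\<And>i. (real_vec b - real_mat A *v v) $ i \<noteq> 0 \<Longrightarrow> \<bar>(real_mat A *v t) $ i\<bar> \<le> 1"
  shows "t = 0"
proof (rule ccontr)
  assume "t \<noteq> 0"
  let ?P = "polyhedron_of A b \<inter> integer_points"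
  have vP: "v \<in> ?P"
    using v extreme_point_of_convex_hull unfolding integer_hull_def by blast
  have "\<bar>(real_mat A *v t) $ i\<bar> \<le> real_vec b $ i - (real_mat A *v v) $ i" for i
  proof (cases "(real_vec b - real_mat A *v v) $ i = 0")
    case True
    then show ?thesis using tight[OF True] by simp
  next
    case False
    have "real_vec b $ i - (real_mat A *v v) $ i \<in> \<int>"
      using vP unfolding real_vec_def matrix_vector_mult_def integer_points_def
      by (auto simp: map_matrix_def intro!: Ints_diff Ints_sum Ints_mult)
    then obtain z where z: "real_vec b $ i - (real_mat A *v v) $ i = real_of_int z"
      by (auto elim: Ints_cases)
    moreover have "0 \<le> real_vec b $ i - (real_mat A *v v) $ i"
      using vP unfolding polyhedron_of_def by simp
    ultimately have "1 \<le> real_of_int z" using False by simp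
    then show ?thesis using z slack[OF False] by linarith
  qed
  then have bound: "\<bar>(real_mat A *v t) $ i\<bar> \<le> real_vec b $ i - (real_mat A *v v) $ i" for i .
  have "v + t \<in> ?P" "v - t \<in> ?P"
    using vP t bound unfolding polyhedron_of_def integer_points_def
    by (auto simp: matrix_vector_right_distrib matrix_vector_mult_diff_distrib abs_le_iff
        algebra_simps intro: Ints_add Ints_diff; smt (verit))+
  then have "v + t \<in> integer_hull A b" "v - t \<in> integer_hull A b"
    unfolding integer_hull_def by (auto intro: hull_inc)
  moreover have "v \<in> open_segment (v - t) (v + t)"
  proof -
    have "v = midpoint (v - t) (v + t)" by (simp add: midpoint_def)
    moreover have "v - t \<noteq> v + t"
    proof
      assume "v - t = v + t"
      then have "v $ j - t $ j = v $ j + t $ j" for j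
        by (metis vector_add_component vector_minus_component)
      then show False using \<open>t \<noteq> 0\<close> by (simp add: vec_eq_iff)
    qed
    ultimately show ?thesis by (metis midpoint_in_open_segment)
  qed
  ultimately show False
    using v unfolding extreme_point_of_def by blast
qed

theorem theorem2:
  fixes A :: "int ^ 'n ^ 'r" and b :: "int ^ 'r" and m :: nat
    and v :: "real ^ 'n" and u :: "real ^ 'r" and \<Delta> c :: real
  assumes "CARD('r) = CARD('n) + m"
    and "rank (real_mat A) = CARD('n)"
    and "\<Delta> = real_of_int (max_subdet A)"
    and "v extreme_point_of integer_hull A b"
    and "u = real_vec b - real_mat A *v v"
    and "c = log 2 (sqrt (2 * (exp 1)\<^sup>2 / (exp 1 - log 2 (exp 1)))) + 1 / 2"
  shows "real (norm0 u) \<le> real m + log 2 (sqrt (real_of_int (det (transpose A ** A))))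
    \<and> (m \<ge> 1 \<longrightarrow>
         real (norm0 u) \<le> c * real m + log 2 \<Delta>
           + real m / 2 * log 2 (log 2 (sqrt (2 * exp 1)) + log 2 \<Delta> / real m))
    \<and> c \<le> 2.27
    \<and> (\<forall>B h. is_basis A B \<and> normalized A b B \<and> bij_betw h UNIV B \<longrightarrow>
         real (norm0 v) \<le> real (norm0 u) + log 2 (real_of_int \<bar>det (row_submatrix A h)\<bar>))"
proof -
  let ?n = "CARD('n)"
  define S where "S = {i. u $ i \<noteq> 0}"
  have k: "norm0 u = card S" unfolding norm0_def S_def ..
  have inj: "inj ((*v) (real_mat A))"
    using assms(2) by (simp add: full_rank_injective)
  have int: "real_mat A $ i $ j \<in> \<int>" for i j by (simp add: map_matrix_def)
  have none: "t = 0" if "\<And>j. t $ j \<in> \<int>" "\<And>i. i \<notin> S \<Longrightarrow> (real_mat A *v t) $ i = 0"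
      "\<And>i. i \<in> S \<Longrightarrow> \<bar>(real_mat A *v t) $ i\<bar> \<le> 1" for t
    using integer_hull_vertex[OF assms(4), of t] that unfolding S_def assms(5) by blast
  obtain T where T: "T \<subseteq> - S" "card T \<le> ?n" "?n \<le> card S + card T"
    and sum: "fact ?n * 4 ^ (?n - card T) \<le>
      (\<Sum>h | inj h \<and> T \<subseteq> range h \<and> range h \<subseteq> S \<union> T. (det (\<chi> i. real_mat A $ h i :: real^'n^'n))\<^sup>2)"
    by (rule minor_sum_lower_bound[OF inj int none])
  define d where "d = ?n - card T"
  let ?H = "{h :: 'n \<Rightarrow> 'r. inj h \<and> T \<subseteq> range h \<and> range h \<subseteq> S \<union> T}"
  have "card S + card T = card (S \<union> T)" using T(1) by (intro card_Un_disjoint[symmetric]) auto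
  also have "\<dots> \<le> CARD('r)" by (intro card_mono) auto
  finally have kd: "d \<le> card S" "card S \<le> d + m"
    using T assms(1) unfolding d_def by linarith+
  have minor: "det (\<chi> i. real_mat A $ h i :: real^'n^'n) = real_of_int (det (\<chi> i. A $ h i))" for h
    unfolding rows_real_mat det_map_of_int ..
  have part1: "real (norm0 u) \<le> real m + log 2 (sqrt (real_of_int (det (transpose A ** A))))"
  proof -
    let ?D = "real_of_int (det (transpose A ** A))"
    \<comment> \<open>Extending the sum of squares to all functions \<open>h\<close> can only
      increase it and makes it a full Gram determinant.\<close>
    have "fact ?n * 4 ^ d \<le> (\<Sum>h\<in>UNIV. (det (\<chi> i. real_mat A $ h i :: real^'n^'n))\<^sup>2)"
      unfolding d_def by (rule order_trans[OF sum sum_mono2]) auto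
    also have "\<dots> = fact ?n * ?D"
      unfolding Cauchy_Binet_gram gram_real_mat det_map_of_int ..
    finally have D: "4 ^ d \<le> ?D" by simp
    have "real d = log 2 (2 ^ d)" by (simp add: log_nat_power)
    also have "(2 :: real) ^ d = sqrt (4 ^ d)"
      by (simp add: real_sqrt_power flip: power_mult)
    also have "log 2 (sqrt (4 ^ d)) \<le> log 2 (sqrt ?D)"
      using D less_le_trans[OF zero_less_power[of 4 d] D] by (subst log_le_cancel_iff) auto
    finally show ?thesis using kd unfolding k by linarith
  qed
  have part2: "real (norm0 u) \<le> c * real m + log 2 \<Delta>
           + real m / 2 * log 2 (log 2 (sqrt (2 * exp 1)) + log 2 \<Delta> / real m)" if m: "m \<ge> 1"
  proof -
    have "(\<Sum>h\<in>?H. (det (\<chi> i. real_mat A $ h i :: real^'n^'n))\<^sup>2) \<le> (\<Sum>h\<in>?H. \<Delta>\<^sup>2)"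
    proof (rule sum_mono)
      fix h assume "h \<in> ?H"
      then have "\<bar>det (\<chi> i. A $ h i)\<bar> \<le> max_subdet A"
        using abs_det_rows_le_max_subdet[OF assms(2)] by simp
      then have "\<bar>det (\<chi> i. real_mat A $ h i :: real^'n^'n)\<bar> \<le> \<Delta>"
        unfolding minor assms(3) by (simp flip: of_int_abs)
      then have "\<bar>det (\<chi> i. real_mat A $ h i :: real^'n^'n)\<bar>\<^sup>2 \<le> \<Delta>\<^sup>2"
        by (intro power_mono) auto
      then show "(det (\<chi> i. real_mat A $ h i :: real^'n^'n))\<^sup>2 \<le> \<Delta>\<^sup>2" by simp
    qed
    also have "\<dots> = real (card ?H) * \<Delta>\<^sup>2" by simp
    also have "\<dots> \<le> real (fact ?n * (card S choose d)) * \<Delta>\<^sup>2"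
      unfolding d_def using T card_inj_prescribed_range[of S T] by (intro mult_right_mono of_nat_mono) auto
    finally have "fact ?n * 4 ^ d \<le> real (fact ?n * (card S choose d)) * \<Delta>\<^sup>2"
      using sum unfolding d_def by linarith
    also have "\<dots> = fact ?n * (real (card S choose d) * \<Delta>\<^sup>2)" by simp
    finally have main: "4 ^ d \<le> real (card S choose d) * \<Delta>\<^sup>2"
      by (subst (asm) mult_le_cancel_left_pos) auto
    \<comment> \<open>Together with nonnegativity and integrality this gives
      \<open>1 \<le> \<Delta>\<close>, so that \<open>log 2 \<Delta>\<close> is nonnegative in the
      numerical estimate.\<close>
    have "\<Delta> \<noteq> 0"
    proof
      assume "\<Delta> = 0"
      then have "(4 :: real) ^ d \<le> 0" using main by simp
      moreover have "0 < (4 :: real) ^ d" by simp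
      ultimately show False by linarith
    qed
    have "0 \<le> max_subdet A"
    proof -
      have "?H \<noteq> {}"
      proof
        assume "?H = {}"
        then have "(\<Sum>h\<in>?H. (det (\<chi> i. real_mat A $ h i :: real^'n^'n))\<^sup>2) = 0"
          by (intro sum.neutral) blast
        then have "fact ?n * (4 :: real) ^ (?n - card T) \<le> 0" using sum by linarith
        moreover have "0 < fact ?n * (4 :: real) ^ (?n - card T)" by simp
        ultimately show False by linarith
      qed
      then obtain h :: "'n \<Rightarrow> 'r" where "inj h" by auto
      then show ?thesis using abs_det_rows_le_max_subdet[OF assms(2), of h] by linarith
    qed
    then have "1 \<le> \<Delta>" using \<open>\<Delta> \<noteq> 0\<close> unfolding assms(3) by simp
    then show ?thesis
      using support_bound_numeric[OF _ m kd main assms(6)] unfolding k by simp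
  qed
  have "c \<le> 2.27" unfolding assms(6) by (rule support_constant_le)
  moreover have "real (norm0 v) \<le> real (norm0 u) + log 2 (real_of_int \<bar>det (row_submatrix A h)\<bar>)"
    if "normalized A b B" "bij_betw h UNIV B" for B h
    using norm0_le_of_normalized[OF that] unfolding assms(5) .
  ultimately show ?thesis using part1 part2 by blast
qed

end
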